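(* For every real $p \ge 4$ we have $C_{p,4} = \dfrac{\gamma_p}{\gamma_4}$.
   Context: Let $\varepsilon_1,\varepsilon_2,\ldots$ be i.i.d. symmetric Bernoulli (Rademacher) random variables, i.e. $\mathbb{P}(\varepsilon_i = \pm 1) = \frac12$. For $a = (a_1,\ldots,a_n) \in \mathbb{R}^n$ put $S_a = \sum_{i=1}^n a_i \varepsilon_i$. For a real random variable $X$ and $p>0$ write $\|X\|_p = (\mathbb{E}|X|^p)^{1/p}$. For $p,q>0$, $C_{p,q}$ denotes the best (smallest) constant, independent of $n\ge 1$ and $a\in\mathbb{R}^n$, such that $\|S_a\|_p \le C_{p,q}\|S_a\|_q$ holds for all $n \ge 1$ and all $a \in \mathbb{R}^n$. Finally, $\gamma_p = (\mathbb{E}|G|^p)^{1/p}$, where $G \sim \mathcal{N}(0,1)$ is a standard Gaussian random variable. *)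

theory Defs
  imports "HOL-Probability.Probability"
begin

definition rademacher_seq :: "'a measure \<Rightarrow> (nat \<Rightarrow> 'a \<Rightarrow> real) \<Rightarrow> bool" where
  "rademacher_seq M \<epsilon> \<longleftrightarrow>
     prob_space M \<and>
     prob_space.indep_vars M (\<lambda>_. borel) \<epsilon> UNIV \<and>
     (\<forall>i. measure M {\<omega> \<in> space M. \<epsilon> i \<omega> = 1} = 1 / 2 \<and>
          measure M {\<omega> \<in> space M. \<epsilon> i \<omega> = - 1} = 1 / 2)"

definition rademacher_sum ::
    "(nat \<Rightarrow> 'a \<Rightarrow> real) \<Rightarrow> nat \<Rightarrow> (nat \<Rightarrow> real) \<Rightarrow> 'a \<Rightarrow> real" where
  "rademacher_sum \<epsilon> n a \<omega> = (\<Sum>i<n. a i * \<epsilon> i \<omega>)"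

definition Lp_norm :: "'a measure \<Rightarrow> real \<Rightarrow> ('a \<Rightarrow> real) \<Rightarrow> real" where
  "Lp_norm M p X = (\<integral>\<omega>. \<bar>X \<omega>\<bar> powr p \<partial>M) powr (1 / p)"

text \<open>A vector of length \<open>n\<close> is a function on \<open>nat\<close> of which only the values at \<open>i < n\<close> are used.\<close>

definition khinchine_bound ::
    "'a measure \<Rightarrow> (nat \<Rightarrow> 'a \<Rightarrow> real) \<Rightarrow> real \<Rightarrow> real \<Rightarrow> real \<Rightarrow> bool" where
  "khinchine_bound M \<epsilon> p q C \<longleftrightarrow>
     (\<forall>n\<ge>1. \<forall>a. Lp_norm M p (rademacher_sum \<epsilon> n a) \<le> C * Lp_norm M q (rademacher_sum \<epsilon> n a))"

text \<open>Being the best constant is a predicate, since a description operator on the reals would be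
  unspecified when no admissible constant exists.\<close>

definition is_best_khinchine_const ::
    "'a measure \<Rightarrow> (nat \<Rightarrow> 'a \<Rightarrow> real) \<Rightarrow> real \<Rightarrow> real \<Rightarrow> real \<Rightarrow> bool" where
  "is_best_khinchine_const M \<epsilon> p q C \<longleftrightarrow>
     khinchine_bound M \<epsilon> p q C \<and> (\<forall>C'. khinchine_bound M \<epsilon> p q C' \<longrightarrow> C \<le> C')"

definition gaussian_norm :: "real \<Rightarrow> real" where
  "gaussian_norm p = Lp_norm std_normal_distribution p (\<lambda>x. x)"

end

theory Submission
  imports Defs
begin

text \<open>
  Write \<open>S = \<Sum> a i * \<epsilon> i\<close>, \<open>V = \<Sum> (a i)^2\<close> and \<open>Q = \<Sum> (a i)^4\<close>. Since
  \<open>E S^4 = 3 V^2 - 2 Q\<close>, the centred Gaussian with the same fourth moment as \<open>S\<close> has variance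
  \<open>\<sigma>\<close> with \<open>\<sigma>^2 = V^2 - 2/3 Q\<close>, and the upper bound says that
  \<open>E |S| powr p \<le> \<sigma> powr (p/2) * E |G| powr p\<close> for \<open>p \<ge> 4\<close>. At \<open>p = 4\<close> this is an equality.
  Two different arguments serve small and large exponents.

  For \<open>4 < p < 6\<close> the function \<open>|x| powr p\<close> is a positive mixture of the functions \<open>k (t * x)\<close>,
  where \<open>k x = x^4/24 - x^2/2 + 1 - cos x \<ge> 0\<close>. So it suffices to compare \<open>S\<close> and the Gaussian on
  \<open>k (t * x)\<close> for each \<open>t\<close> (\<open>sign_avg_cos_remainder_le\<close>). The fourth moments cancel and what is left
  is the inequality \<open>\<Prod> cos (b i) \<ge> exp (- \<sigma>/2) - (V - \<sigma>)/2\<close> for the angles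
  \<open>b i = t * a i\<close>, with \<open>V\<close> and \<open>\<sigma>\<close> now formed from these (\<open>prod_cos_ge\<close>). When at most one angle exceeds \<open>pi/2\<close>, the cosines are replaced one
  at a time by Gaussian factors in such a way that \<open>\<sigma>\<close> never changes; each exchange reduces
  to a single cosine. With two or more large angles the gap \<open>V - \<sigma>\<close> is so large that crude
  bounds suffice.

  For \<open>p \<ge> 6\<close> one descends by two: \<open>E |S| powr p \<le> (p - 1) * \<sigma> * E |S| powr (p - 2)\<close>
  (\<open>sign_avg_moment_step\<close>). For the Gaussian this holds with equality, so the bound propagates from
  \<open>p - 2 \<ge> 4\<close> to \<open>p\<close>. Integration by parts in each sign turns \<open>E |S| powr p\<close> into the sum
  over the coefficients \<open>c\<close> of \<open>(p - 1) * c^2 * E |Y + c U| powr (p - 2)\<close>, where the sign with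
  coefficient \<open>c\<close> is replaced by a uniform variable \<open>U\<close> on \<open>[-1, 1]\<close> and \<open>Y\<close> is the rest of \<open>S\<close>.
  This expectation is at most the fraction \<open>1 - 2/3 c^2/V\<close> of \<open>E |S| powr (p - 2)\<close>
  (\<open>uniform_average_le\<close>), and summing these fractions with the weights \<open>c^2\<close> yields
  \<open>(V^2 - 2/3 Q)/V = \<sigma>^2/V \<le> \<sigma>\<close>.

  The constant cannot be improved: by the central limit theorem the normalised sums with equal
  coefficients approach the Gaussian in distribution, which bounds the \<open>p\<close>-th moments from below, while
  their fourth moments \<open>3 - 2/n\<close> are explicit.
\<close>

section \<open>Averages over random signs\<close>

text \<open>The expectation of \<open>f (x + \<Sum> a i * \<epsilon> i)\<close>, written as a finite sum over the set \<open>A\<close> of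
  indices with positive sign. No measure theory enters, and the shift \<open>x\<close> makes inductions on \<open>I\<close> and
  differentiation possible.\<close>

definition sign_avg :: "'i set \<Rightarrow> ('i \<Rightarrow> real) \<Rightarrow> (real \<Rightarrow> real) \<Rightarrow> real \<Rightarrow> real" where
  "sign_avg I a f x = (\<Sum>A\<in>Pow I. f (x + (\<Sum>i\<in>A. a i) - (\<Sum>i\<in>I - A. a i))) / 2 ^ card I"

lemma sign_avg_empty [simp]: "sign_avg {} a f x = f x"
  by (simp add: sign_avg_def)

lemma sign_avg_insert:
  assumes "finite I" "i \<notin> I"
  shows "sign_avg (insert i I) a f x = (sign_avg I a f (x + a i) + sign_avg I a f (x - a i)) / 2"
proof -
  let ?g = "\<lambda>A. f (x + (\<Sum>j\<in>A. a j) - (\<Sum>j\<in>insert i I - A. a j))"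
  have inj: "inj_on (insert i) (Pow I)"
    using assms(2) by (auto simp: inj_on_def)
  have plus: "?g (insert i A) = f (x + a i + (\<Sum>j\<in>A. a j) - (\<Sum>j\<in>I - A. a j))" if "A \<in> Pow I" for A
  proof -
    have "finite A" "i \<notin> A" using that assms by (auto intro: finite_subset)
    moreover have "insert i I - insert i A = I - A" using assms by auto
    ultimately show ?thesis by (simp add: algebra_simps)
  qed
  have minus: "?g A = f (x - a i + (\<Sum>j\<in>A. a j) - (\<Sum>j\<in>I - A. a j))" if "A \<in> Pow I" for A
  proof -
    have "insert i I - A = insert i (I - A)" using that assms by auto
    then show ?thesis using assms by (simp add: algebra_simps)
  qed
  have "(\<Sum>A\<in>Pow (insert i I). ?g A) = (\<Sum>A\<in>Pow I. ?g A) + (\<Sum>A\<in>insert i ` Pow I. ?g A)"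
    unfolding Pow_insert using assms by (intro sum.union_disjoint) auto
  also have "(\<Sum>A\<in>insert i ` Pow I. ?g A) = (\<Sum>A\<in>Pow I. ?g (insert i A))"
    by (simp add: sum.reindex[OF inj])
  also have "(\<Sum>A\<in>Pow I. ?g A) = (\<Sum>A\<in>Pow I. f (x - a i + (\<Sum>j\<in>A. a j) - (\<Sum>j\<in>I - A. a j)))"
    by (intro sum.cong refl minus)
  also have "(\<Sum>A\<in>Pow I. ?g (insert i A)) = (\<Sum>A\<in>Pow I. f (x + a i + (\<Sum>j\<in>A. a j) - (\<Sum>j\<in>I - A. a j)))"
    by (intro sum.cong refl plus)
  finally show ?thesis
    using assms by (simp add: sign_avg_def field_simps)
qed

lemma sign_avg_add: "sign_avg I a (\<lambda>x. f x + g x) x = sign_avg I a f x + sign_avg I a g x"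
  by (simp add: sign_avg_def sum.distrib add_divide_distrib)

lemma sign_avg_diff: "sign_avg I a (\<lambda>x. f x - g x) x = sign_avg I a f x - sign_avg I a g x"
  by (simp add: sign_avg_def sum_subtractf diff_divide_distrib)

lemma sign_avg_cmult: "sign_avg I a (\<lambda>x. c * f x) x = c * sign_avg I a f x"
  by (simp add: sign_avg_def sum_distrib_left)

lemma sign_avg_nonneg:
  assumes "\<And>x. 0 \<le> f x"
  shows "0 \<le> sign_avg I a f x"
  unfolding sign_avg_def by (intro divide_nonneg_nonneg sum_nonneg assms) simp

lemma sign_avg_mono_arg:
  assumes "mono f" "x \<le> y"
  shows "sign_avg I a f x \<le> sign_avg I a f y"
  unfolding sign_avg_def using assms(2)
  by (intro divide_right_mono sum_mono monoD[OF assms(1)]) auto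

lemma sign_avg_const: 
  assumes "finite I"
  shows "sign_avg I a (\<lambda>_. c) x = c"
  using assms by (simp add: sign_avg_def card_Pow)

lemma DERIV_sign_avg:
  assumes "\<And>x. (f has_real_derivative f' x) (at x)"
  shows "(sign_avg I a f has_real_derivative sign_avg I a f' x) (at x)"
proof -
  have "((\<lambda>x. f (x + c - d)) has_real_derivative f' (x + c - d)) (at x)" for c d
  proof -
    have "((\<lambda>x. x + c - d) has_real_derivative 1) (at x)"
      by (auto intro!: derivative_eq_intros)
    from DERIV_chain2[OF assms this] show ?thesis by simp
  qed
  then show ?thesis
    unfolding sign_avg_def[abs_def] by (intro DERIV_cdivide DERIV_sum) 
qed

lemma sign_avg_uminus:
  assumes "finite I"
  shows "sign_avg I a f (- x) = sign_avg I a (\<lambda>y. f (- y)) x"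
  using assms
proof (induction I arbitrary: x rule: finite_induct)
  case (insert i I)
  show ?case
    using insert.IH[of "x - a i"] insert.IH[of "x + a i"] insert.hyps
    by (simp add: sign_avg_insert algebra_simps)
qed simp

lemma sign_avg_square:
  assumes "finite I"
  shows "sign_avg I a (\<lambda>x. x ^ 2) x = x ^ 2 + (\<Sum>i\<in>I. a i ^ 2)"
  using assms
proof (induction I arbitrary: x rule: finite_induct)
  case (insert i I)
  then show ?case by (simp add: sign_avg_insert algebra_simps power2_eq_square)
qed simp

lemma sign_avg_fourth:
  assumes "finite I"
  shows "sign_avg I a (\<lambda>x. x ^ 4) x = x ^ 4 + 6 * x ^ 2 * (\<Sum>i\<in>I. a i ^ 2)
           + 3 * (\<Sum>i\<in>I. a i ^ 2) ^ 2 - 2 * (\<Sum>i\<in>I. a i ^ 4)"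
  using assms
proof (induction I arbitrary: x rule: finite_induct)
  case (insert i I)
  then show ?case 
    by (simp add: sign_avg_insert) (simp add: algebra_simps power2_eq_square power4_eq_xxxx)
qed simp

lemma sign_avg_cos:
  assumes "finite I"
  shows "sign_avg I a (\<lambda>x. cos (t * x)) x = cos (t * x) * (\<Prod>i\<in>I. cos (t * a i))"
  using assms
proof (induction I arbitrary: x rule: finite_induct)
  case (insert i I)
  then show ?case 
    by (simp add: sign_avg_insert algebra_simps cos_add cos_diff)
qed simp

text \<open>Integration by parts for signs: \<open>x + \<Sum> a i * \<epsilon> i\<close> is multiplied out, and in the \<open>i\<close>-th term the
  expectation over \<open>\<epsilon> i\<close> turns \<open>\<epsilon> i * g\<close> into a symmetric difference of \<open>g\<close>.\<close>

lemma sign_avg_mult_arg: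
  assumes "finite I"
  shows "sign_avg I a (\<lambda>x. x * g x) x = x * sign_avg I a g x
    + (\<Sum>i\<in>I. a i * ((sign_avg (I - {i}) a g (x + a i) - sign_avg (I - {i}) a g (x - a i)) / 2))"
  using assms
proof (induction I arbitrary: x rule: finite_induct)
  case (insert i I)
  have *: "sign_avg (insert i I - {j}) a g y = (sign_avg (I - {j}) a g (y + a i) + sign_avg (I - {j}) a g (y - a i)) / 2"
    if "j \<in> I" for j y
  proof -
    have "insert i I - {j} = insert i (I - {j})" using that insert by auto
    then show ?thesis using insert.hyps by (simp add: sign_avg_insert)
  qed
  let ?D = "\<lambda>j y. a j * ((sign_avg (I - {j}) a g (y + a j) - sign_avg (I - {j}) a g (y - a j)) / 2)"
  have "(\<Sum>j\<in>I. a j * ((sign_avg (insert i I - {j}) a g (x + a j) - sign_avg (insert i I - {j}) a g (x - a j)) / 2))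
     = (\<Sum>j\<in>I. (?D j (x + a i) + ?D j (x - a i)) / 2)"
    by (intro sum.cong refl) (simp add: * field_simps)
  also have "\<dots> = ((\<Sum>j\<in>I. ?D j (x + a i)) + (\<Sum>j\<in>I. ?D j (x - a i))) / 2"
    by (simp add: sum.distrib flip: sum_divide_distrib)
  finally show ?case
    using insert by (simp add: sign_avg_insert field_simps)
qed simp

section \<open>Derivatives of real powers of the absolute value\<close>

definition signed_powr :: "real \<Rightarrow> real \<Rightarrow> real" where
  "signed_powr r x = sgn x * \<bar>x\<bar> powr r"

lemma mult_signed_powr: "x * signed_powr r x = \<bar>x\<bar> powr (r + 1)"
proof (cases "x = 0")
  case False
  then have "x * signed_powr r x = \<bar>x\<bar> * \<bar>x\<bar> powr r" by (simp add: signed_powr_def abs_sgn)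
  also have "\<dots> = \<bar>x\<bar> powr (r + 1)" using False by (simp add: powr_add)
  finally show ?thesis .
qed simp

lemma signed_powr_minus: "signed_powr r (- x) = - signed_powr r x"
  by (simp add: signed_powr_def sgn_minus)

lemma mono_signed_powr:
  assumes "r \<ge> 0"
  shows "mono (signed_powr r)"
proof (rule monoI)
  fix x y :: real assume "x \<le> y"
  then consider "0 < x" | "y < 0" | "x \<le> 0" "y \<ge> 0" by linarith
  then show "signed_powr r x \<le> signed_powr r y"
  proof cases
    case 3
    then have "signed_powr r x \<le> 0" "0 \<le> signed_powr r y"
      by (auto simp: signed_powr_def sgn_if)
    then show ?thesis by linarith
  qed (use \<open>x \<le> y\<close> assms in \<open>auto simp: signed_powr_def intro!: powr_mono2\<close>)
qed

lemma tendsto_abs_powr_0: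
  assumes "(r::real) > 0"
  shows "((\<lambda>h. \<bar>h::real\<bar> powr r) \<longlongrightarrow> 0) (at 0)"
proof -
  have "continuous (at 0) (\<lambda>h::real. \<bar>h\<bar> powr r)"
    using assms by (auto intro!: continuous_intros)
  then show ?thesis by (simp add: continuous_within)
qed

lemma DERIV_abs_powr:
  assumes "r > 1"
  shows "((\<lambda>x. \<bar>x\<bar> powr r) has_real_derivative r * signed_powr (r - 1) x) (at x)"
proof (cases "x = 0")
  case True
  have "((\<lambda>h. signed_powr (r - 1) h) \<longlongrightarrow> 0) (at 0)"
  proof (rule Lim_null_comparison)
    show "\<forall>\<^sub>F h in at 0. norm (signed_powr (r - 1) h) \<le> \<bar>h\<bar> powr (r - 1)"
      by (intro always_eventually) (auto simp: signed_powr_def abs_mult sgn_if)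
  qed (use assms in \<open>auto intro: tendsto_abs_powr_0\<close>)
  moreover have "\<forall>\<^sub>F h in at 0. signed_powr (r - 1) h = \<bar>h\<bar> powr r / h"
    unfolding eventually_at_filter
  proof (intro always_eventually allI impI)
    fix h :: real assume "h \<noteq> 0"
    then show "signed_powr (r - 1) h = \<bar>h\<bar> powr r / h"
      using mult_signed_powr[of h "r - 1"] by (simp add: field_simps)
  qed
  ultimately have "((\<lambda>h. \<bar>h\<bar> powr r / h) \<longlongrightarrow> 0) (at 0)"
    using tendsto_cong by fast
  then show ?thesis
    using True by (simp add: DERIV_def signed_powr_def)
next
  case False
  show ?thesis
  proof (cases "x > 0")
    case True
    have "((\<lambda>x. x powr r) has_real_derivative r * signed_powr (r - 1) x) (at x)"
      using True by (auto intro!: derivative_eq_intros simp: signed_powr_def)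
    then show ?thesis
      by (rule has_field_derivative_transform_within_open[where S = "{0<..}"]) (use True in \<open>auto simp: dist_real_def abs_if split: if_splits\<close>)
  next
    case F: False
    with False have "x < 0" by simp
    have "((\<lambda>x. (- x) powr r) has_real_derivative r * signed_powr (r - 1) x) (at x)"
      using \<open>x < 0\<close> by (auto intro!: derivative_eq_intros simp: signed_powr_def)
    then show ?thesis
      by (rule has_field_derivative_transform_within_open[where S = "{..<0}"]) (use \<open>x < 0\<close> in \<open>auto simp: dist_real_def abs_if split: if_splits\<close>)
  qed
qed

lemma DERIV_signed_powr:
  assumes "r > 1"
  shows "(signed_powr r has_real_derivative r * \<bar>x\<bar> powr (r - 1)) (at x)"
proof (cases "x = 0")
  case True
  have "\<forall>\<^sub>F h in at 0. \<bar>h\<bar> powr (r - 1) = signed_powr r h / h"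
    unfolding eventually_at_filter
  proof (intro always_eventually allI impI)
    fix h :: real assume "h \<noteq> 0"
    moreover have "\<bar>h\<bar> powr r = \<bar>h\<bar> powr (r - 1) * \<bar>h\<bar>" 
      using \<open>h \<noteq> 0\<close> by (simp add: powr_diff)
    ultimately show "\<bar>h\<bar> powr (r - 1) = signed_powr r h / h"
      by (simp add: signed_powr_def sgn_if)
  qed
  then have "((\<lambda>h. signed_powr r h / h) \<longlongrightarrow> 0) (at 0)"
    using tendsto_cong[of _ _ "at 0" "0::real"] tendsto_abs_powr_0[of "r - 1"] assms by fastforce
  then show ?thesis
    using True by (simp add: DERIV_def signed_powr_def)
next
  case False
  show ?thesis
  proof (cases "x > 0")
    case True
    have "((\<lambda>x. x powr r) has_real_derivative r * \<bar>x\<bar> powr (r - 1)) (at x)"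
      using True by (auto intro!: derivative_eq_intros)
    then show ?thesis
      by (rule has_field_derivative_transform_within_open[where S = "{0<..}"])
         (use True in \<open>auto simp: dist_real_def signed_powr_def abs_if sgn_if split: if_splits\<close>)
  next
    case F: False
    with False have "x < 0" by simp
    have "((\<lambda>x. - ((- x) powr r)) has_real_derivative r * \<bar>x\<bar> powr (r - 1)) (at x)"
      using \<open>x < 0\<close> by (auto intro!: derivative_eq_intros)
    then show ?thesis
      by (rule has_field_derivative_transform_within_open[where S = "{..<0}"])
         (use \<open>x < 0\<close> in \<open>auto simp: dist_real_def signed_powr_def abs_if sgn_if split: if_splits\<close>)
  qed
qed

section \<open>Descending from exponent p to p - 2\<close>

text \<open>The trapezoidal rule overestimates the integral of a convex \<open>k'\<close> over \<open>[x - c, x + c]\<close>. The extra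
  factor \<open>c\<close> makes the inequality even in \<open>c\<close>, so that no sign of \<open>c\<close> has to be assumed.\<close>

lemma trapezoid:
  fixes k k' k'' :: "real \<Rightarrow> real"
  assumes "\<And>x. (k has_real_derivative k' x) (at x)"
    and "\<And>x. (k' has_real_derivative k'' x) (at x)"
    and "mono k''"
  shows "c * (k (x + c) - k (x - c)) \<le> c ^ 2 * (k' (x + c) + k' (x - c))"
proof -
  have pos: "k (x + c) - k (x - c) \<le> c * (k' (x + c) + k' (x - c))" if "c \<ge> 0" for c
  proof -
    define g where "g c = c * (k' (x + c) + k' (x - c)) - (k (x + c) - k (x - c))" for c
    have "g 0 \<le> g c"
    proof (rule DERIV_nonneg_imp_nondecreasing[OF that], intro exI conjI)
      fix y :: real assume "0 \<le> y" "y \<le> c"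
      show "(g has_real_derivative y * (k'' (x + y) - k'' (x - y))) (at y)"
        unfolding g_def
        by (auto intro!: derivative_eq_intros DERIV_chain2[OF assms(1)] DERIV_chain2[OF assms(2)]
            simp: algebra_simps)
      show "0 \<le> y * (k'' (x + y) - k'' (x - y))"
        using monoD[OF assms(3), of "x - y" "x + y"] \<open>0 \<le> y\<close> by simp
    qed
    then show ?thesis by (simp add: g_def)
  qed
  show ?thesis
  proof (cases "c \<ge> 0")
    case True
    then show ?thesis using mult_left_mono[OF pos[OF True] True] by (simp add: power2_eq_square mult.assoc)
  next
    case False
    then have "(- c) * (k (x - c) - k (x + c)) \<le> (- c) * ((- c) * (k' (x - c) + k' (x + c)))"
      using pos[of "- c"] by (intro mult_left_mono) auto
    then show ?thesis by (simp add: power2_eq_square algebra_simps)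
  qed
qed

text \<open>The counterpart of the identity \<open>E G g(G) = E g'(G)\<close>: for signs the symmetric differences in
  \<open>sign_avg_mult_arg\<close> are averages of \<open>g'\<close> over an interval, and for convex \<open>g'\<close> the average over the
  end points is larger.\<close>

lemma sign_avg_mult_arg_le:
  fixes g g' g'' :: "real \<Rightarrow> real"
  assumes "finite I"
    and g: "\<And>x. (g has_real_derivative g' x) (at x)"
    and g': "\<And>x. (g' has_real_derivative g'' x) (at x)"
    and "mono g''"
  shows "sign_avg I a (\<lambda>x. x * g x) x
    \<le> x * sign_avg I a g x + (\<Sum>i\<in>I. a i ^ 2) * sign_avg I a g' x"
proof -
  have "a i * ((sign_avg (I - {i}) a g (x + a i) - sign_avg (I - {i}) a g (x - a i)) / 2)
      \<le> a i ^ 2 * sign_avg I a g' x" if "i \<in> I" for i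
  proof -
    have "mono (sign_avg (I - {i}) a g'')"
      by (intro monoI sign_avg_mono_arg assms)
    from trapezoid[OF DERIV_sign_avg[OF g] DERIV_sign_avg[OF g'] this, of "a i" x]
    have "a i * (sign_avg (I - {i}) a g (x + a i) - sign_avg (I - {i}) a g (x - a i))
       \<le> a i ^ 2 * (sign_avg (I - {i}) a g' (x + a i) + sign_avg (I - {i}) a g' (x - a i))" .
    moreover have "insert i (I - {i}) = I" using that by auto
    then have "sign_avg I a g' x = (sign_avg (I - {i}) a g' (x + a i) + sign_avg (I - {i}) a g' (x - a i)) / 2"
      using sign_avg_insert[of "I - {i}" i a g' x] assms(1) by simp
    ultimately show ?thesis by (simp only:)
  qed
  then have "(\<Sum>i\<in>I. a i * ((sign_avg (I - {i}) a g (x + a i) - sign_avg (I - {i}) a g (x - a i)) / 2))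
     \<le> (\<Sum>i\<in>I. a i ^ 2) * sign_avg I a g' x"
    by (simp add: sum_distrib_right sum_mono)
  then show ?thesis
    by (simp add: sign_avg_mult_arg[OF assms(1)])
qed

text \<open>Let \<open>Y\<close> be the signed sum over \<open>I\<close>, with variance \<open>m\<close>, and \<open>h y = E |Y + y| powr r\<close>. The left side
  contains the antiderivative of \<open>h\<close>, so for a uniform \<open>U\<close> on \<open>[-1, 1]\<close> and a random sign \<open>\<epsilon>\<close> the
  statement is
  \<open>E |Y + c U| powr r / E |Y + c \<epsilon>| powr r \<le> E |Y + c U|^2 / E |Y + c \<epsilon>|^2\<close>.
  Taking two derivatives in \<open>c\<close> reduces it to \<open>2 h \<le> 2/3 c h' + (m + c^2/3) h''\<close>, and this follows from
  \<open>r h \<le> c h' + m h''\<close>, which is \<open>sign_avg_mult_arg_le\<close> for \<open>g = |x| powr (r - 1)\<close> with the sign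
  of \<open>x\<close>.\<close>

lemma uniform_average_le:
  fixes a :: "'i \<Rightarrow> real" and c r :: real
  assumes "finite I" "r \<ge> 4"
  defines "m \<equiv> (\<Sum>i\<in>I. a i ^ 2)"
  shows "(m + c ^ 2) * (c * sign_avg I a (signed_powr (r + 1)) c)
    \<le> (r + 1) * c ^ 2 * (m + c ^ 2 / 3) * sign_avg I a (\<lambda>x. \<bar>x\<bar> powr r) c"
proof -
  define h where "h = sign_avg I a (\<lambda>x. \<bar>x\<bar> powr r)"
  define H where "H = sign_avg I a (signed_powr (r + 1))"
  define h' where "h' = sign_avg I a (signed_powr (r - 1))"
  define h'' where "h'' = sign_avg I a (\<lambda>x. \<bar>x\<bar> powr (r - 2))"
  have "m \<ge> 0" by (simp add: m_def sum_nonneg)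
  have H: "(H has_real_derivative (r + 1) * h x) (at x)" for x
    unfolding H_def h_def sign_avg_cmult[symmetric]
    by (rule DERIV_sign_avg) (use DERIV_signed_powr[of "r + 1"] assms(2) in simp)
  have h: "(h has_real_derivative r * h' x) (at x)" for x
    unfolding h_def h'_def sign_avg_cmult[symmetric]
    by (rule DERIV_sign_avg) (use DERIV_abs_powr[of "r"] assms(2) in simp)
  have h': "(h' has_real_derivative (r - 1) * h'' x) (at x)" for x
    unfolding h''_def h'_def sign_avg_cmult[symmetric]
    by (rule DERIV_sign_avg) (use DERIV_signed_powr[of "r - 1"] assms(2) in simp)
  have odd: "sign_avg I a (signed_powr s) (- x) = - sign_avg I a (signed_powr s) x" for s x
    using sign_avg_uminus[OF assms(1), of a "signed_powr s" x] sign_avg_cmult[of I a "-1" "signed_powr s" x]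
    by (simp add: signed_powr_minus)
  have "H 0 = 0" "h' 0 = 0" using odd[of "r + 1" 0] odd[of "r - 1" 0] by (simp_all add: H_def h'_def)
  have "h'' x \<ge> 0" for x unfolding h''_def by (rule sign_avg_nonneg) simp
  have "h' x \<ge> 0" if "x \<ge> 0" for x
  proof -
    have "h' 0 \<le> h' x"
      by (rule DERIV_nonneg_imp_nondecreasing[OF that])
         (use h' \<open>\<And>x. h'' x \<ge> 0\<close> assms(2) in \<open>auto intro!: exI mult_nonneg_nonneg\<close>)
    with \<open>h' 0 = 0\<close> show ?thesis by simp
  qed
  have key: "h x \<le> x * h' x + m * ((r - 1) * h'' x)" for x
  proof -
    have "sign_avg I a (\<lambda>x. x * signed_powr (r - 1) x) x
      \<le> x * sign_avg I a (signed_powr (r - 1)) x + m * sign_avg I a (\<lambda>x. (r - 1) * \<bar>x\<bar> powr (r - 2)) x"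
      unfolding m_def
    proof (rule sign_avg_mult_arg_le[OF assms(1)])
      show "(signed_powr (r - 1) has_real_derivative (r - 1) * \<bar>x\<bar> powr (r - 2)) (at x)" for x
        using DERIV_signed_powr[of "r - 1"] assms(2) by simp
      show "((\<lambda>x. (r - 1) * \<bar>x\<bar> powr (r - 2)) has_real_derivative
         (r - 1) * ((r - 2) * signed_powr (r - 3) x)) (at x)" for x
        using DERIV_abs_powr[of "r - 2"] assms(2) by (auto intro!: DERIV_cmult)
      show "mono (\<lambda>x. (r - 1) * ((r - 2) * signed_powr (r - 3) x))"
        using assms(2) by (intro monoI mult_left_mono monoD[OF mono_signed_powr]) auto
    qed
    then show ?thesis by (simp add: mult_signed_powr sign_avg_cmult h_def h'_def h''_def)
  qed
  (* The difference of the two sides, divided by x, has derivative x * u x; see w below. *)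
  define u where "u x = (r + 1) * r * (m + x ^ 2 / 3) * h' x - 2 * H x" for x
  have u: "u x \<ge> 0" if "x \<ge> 0" for x
  proof -
    have "u 0 \<le> u x"
    proof (rule DERIV_nonneg_imp_nondecreasing[OF that], intro exI conjI)
      fix y :: real assume y: "0 \<le> y" "y \<le> x"
      show "(u has_real_derivative (r + 1) * (r * (2 * y / 3) * h' y
         + r * (m + y ^ 2 / 3) * ((r - 1) * h'' y) - 2 * h y)) (at y)"
        unfolding u_def by (auto intro!: derivative_eq_intros H h') (simp add: algebra_simps add_divide_distrib diff_divide_distrib)
      have "2 * h y \<le> 2 * (y * h' y) + 2 * (m * ((r - 1) * h'' y))" using key[of y] by simp
      also have "\<dots> \<le> (r * (2 / 3)) * (y * h' y) + r * (m * ((r - 1) * h'' y))"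
        using assms(2) y \<open>m \<ge> 0\<close> \<open>\<And>x. h'' x \<ge> 0\<close> \<open>\<And>x. 0 \<le> x \<Longrightarrow> h' x \<ge> 0\<close>
        by (intro add_mono mult_right_mono) auto
      also have "\<dots> \<le> r * (2 * y / 3) * h' y + r * (m + y ^ 2 / 3) * ((r - 1) * h'' y)"
      proof -
        have "0 \<le> r * (y ^ 2 / 3) * ((r - 1) * h'' y)"
          using assms(2) \<open>\<And>x. h'' x \<ge> 0\<close> by (intro mult_nonneg_nonneg) auto
        then show ?thesis by (simp add: algebra_simps)
      qed
      finally show "0 \<le> (r + 1) * (r * (2 * y / 3) * h' y
         + r * (m + y ^ 2 / 3) * ((r - 1) * h'' y) - 2 * h y)"
        using assms(2) by simp
    qed
    then show ?thesis using \<open>H 0 = 0\<close> \<open>h' 0 = 0\<close> by (simp add: u_def)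
  qed
  have pos: "(m + x ^ 2) * H x \<le> (r + 1) * x * (m + x ^ 2 / 3) * h x" if "x \<ge> 0" for x
  proof -
    define w where "w x = (r + 1) * x * (m + x ^ 2 / 3) * h x - (m + x ^ 2) * H x" for x
    have "w 0 \<le> w x"
    proof (rule DERIV_nonneg_imp_nondecreasing[OF that], intro exI conjI)
      fix y :: real assume y: "0 \<le> y" "y \<le> x"
      show "(w has_real_derivative y * u y) (at y)"
        unfolding w_def u_def 
        by (auto intro!: derivative_eq_intros H h simp: algebra_simps power2_eq_square)
      show "0 \<le> y * u y" using y u by simp
    qed
    then show ?thesis using \<open>H 0 = 0\<close> by (simp add: w_def)
  qed
  have even: "h (- x) = h x" for x
    using sign_avg_uminus[OF assms(1), of a "\<lambda>x. \<bar>x\<bar> powr r" x] by (simp add: h_def)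
  have "(m + c ^ 2) * (\<bar>c\<bar> * H \<bar>c\<bar>) \<le> (r + 1) * c ^ 2 * (m + c ^ 2 / 3) * h \<bar>c\<bar>"
    using mult_left_mono[OF pos[of "\<bar>c\<bar>"], of "\<bar>c\<bar>"] by (simp add: power2_eq_square ac_simps)
  moreover have "\<bar>c\<bar> * H \<bar>c\<bar> = c * H c" "h \<bar>c\<bar> = h c"
    using even[of c] odd[of "r + 1" c] by (auto simp: abs_if H_def)
  ultimately show ?thesis by (simp add: h_def H_def)
qed

text \<open>Writing \<open>|x| powr p\<close> as \<open>x * g x\<close> and integrating by parts, the \<open>i\<close>-th term is an average over a
  uniform variable and \<open>uniform_average_le\<close> bounds it by
  \<open>(p - 1) * (a i)^2 * (1 - 2/3 (a i)^2/V)\<close> times the moment of order \<open>p - 2\<close>. The choice of \<open>\<sigma>\<close>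
  makes the sum of these factors equal to \<open>(p - 1) * \<sigma>^2/V\<close>.\<close>

lemma sign_avg_moment_step:
  fixes a :: "'i \<Rightarrow> real" and p \<sigma> :: real
  assumes "finite I" "p \<ge> 6"
  defines "V \<equiv> (\<Sum>i\<in>I. a i ^ 2)" and "Q \<equiv> (\<Sum>i\<in>I. a i ^ 4)"
  assumes \<sigma>: "\<sigma> \<ge> 0" "\<sigma> ^ 2 = V ^ 2 - 2 / 3 * Q"
  shows "sign_avg I a (\<lambda>x. \<bar>x\<bar> powr p) 0 \<le> (p - 1) * \<sigma> * sign_avg I a (\<lambda>x. \<bar>x\<bar> powr (p - 2)) 0"
proof (cases "V = 0")
  case True
  then have "\<forall>i\<in>I. a i = 0" 
    using assms(1) by (simp add: V_def sum_nonneg_eq_0_iff)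
  then have "sign_avg I a (\<lambda>x. \<bar>x\<bar> powr p) 0 = 0"
    using assms(1)
    by (auto simp: sign_avg_def intro!: sum.neutral) (meson Diff_iff subsetD sum.neutral)
  then show ?thesis 
    using \<sigma> assms(2) by (auto intro!: mult_nonneg_nonneg sign_avg_nonneg)
next
  case False
  then have "V > 0" by (simp add: V_def less_le sum_nonneg)
  define h where "h = sign_avg I a (\<lambda>x. \<bar>x\<bar> powr (p - 2)) 0"
  have "h \<ge> 0" unfolding h_def by (rule sign_avg_nonneg) simp
  let ?G = "signed_powr (p - 1)"
  have term_le: "a i * ((sign_avg (I - {i}) a ?G (0 + a i) - sign_avg (I - {i}) a ?G (0 - a i)) / 2)
     \<le> (p - 1) * h * (a i ^ 2 - 2 / 3 * a i ^ 4 / V)" if "i \<in> I" for i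
  proof -
    have fin: "finite (I - {i})" using assms(1) by simp
    have ins: "insert i (I - {i}) = I" using that by auto
    have V: "V = (\<Sum>j\<in>I - {i}. a j ^ 2) + a i ^ 2"
      unfolding V_def using that assms(1) by (simp add: sum.remove)
    have odd: "sign_avg (I - {i}) a ?G (- a i) = - sign_avg (I - {i}) a ?G (a i)"
      using sign_avg_uminus[OF fin, of a ?G "a i"] sign_avg_cmult[of "I - {i}" a "-1" ?G "a i"]
      by (simp add: signed_powr_minus)
    have even: "sign_avg (I - {i}) a (\<lambda>x. \<bar>x\<bar> powr (p - 2)) (a i) = h"
      using sign_avg_insert[OF fin, of i a "\<lambda>x. \<bar>x\<bar> powr (p - 2)" 0] 
        sign_avg_uminus[OF fin, of a "\<lambda>x. \<bar>x\<bar> powr (p - 2)" "a i"] by (simp only: ins h_def) simp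
    have "V * (a i * sign_avg (I - {i}) a ?G (a i)) \<le> (p - 1) * a i ^ 2 * (V - 2 / 3 * a i ^ 2) * h"
      using uniform_average_le[OF fin, of "p - 2" a "a i"] assms(2) by (simp add: V even algebra_simps)
    then have "a i * sign_avg (I - {i}) a ?G (a i) \<le> (p - 1) * a i ^ 2 * (V - 2 / 3 * a i ^ 2) * h / V"
      using \<open>V > 0\<close> by (simp add: field_simps)
    also have "\<dots> = (p - 1) * h * (a i ^ 2 - 2 / 3 * a i ^ 4 / V)"
      using \<open>V > 0\<close> by (simp add: field_simps power2_eq_square power4_eq_xxxx)
    finally show ?thesis by (simp add: odd)
  qed
  have "sign_avg I a (\<lambda>x. \<bar>x\<bar> powr p) 0 = sign_avg I a (\<lambda>x. x * ?G x) 0"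
    by (simp add: mult_signed_powr)
  also have "\<dots> \<le> (\<Sum>i\<in>I. (p - 1) * h * (a i ^ 2 - 2 / 3 * a i ^ 4 / V))"
    unfolding sign_avg_mult_arg[OF assms(1)] using term_le by (auto intro!: sum_mono)
  also have "\<dots> = (p - 1) * h * (V - 2 / 3 * Q / V)"
    by (simp add: V_def Q_def sum_subtractf flip: sum_distrib_left sum_divide_distrib)
  also have "V - 2 / 3 * Q / V = \<sigma> ^ 2 / V"
    unfolding \<sigma>(2) using \<open>V > 0\<close> by (simp add: diff_divide_distrib power2_eq_square)
  also have "(p - 1) * h * (\<sigma> ^ 2 / V) \<le> (p - 1) * h * \<sigma>"
  proof (rule mult_left_mono)
    have "\<sigma> ^ 2 \<le> V ^ 2" unfolding \<sigma> Q_def by (simp add: sum_nonneg)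
    then have "\<sigma> \<le> V" using \<open>V > 0\<close> by (auto intro: power2_le_imp_le)
    then have "\<sigma> * \<sigma> \<le> \<sigma> * V" using \<sigma> by (intro mult_left_mono)
    then show "\<sigma> ^ 2 / V \<le> \<sigma>"
      using \<open>V > 0\<close> by (simp add: field_simps power2_eq_square)
  qed (use \<open>h \<ge> 0\<close> assms(2) in simp)
  finally show ?thesis by (simp add: h_def ac_simps)
qed

section \<open>A lower bound for products of cosines\<close>

lemma cos_taylor_upper: "cos x \<le> 1 - x ^ 2 / 2 + x ^ 4 / (24::real)"
  and cos_taylor_lower: "1 - x ^ 2 / 2 + x ^ 4 / 24 - x ^ 6 / 720 \<le> cos (x::real)"
proof -
  have s1: "sin y \<le> y" if "y \<ge> 0" for y :: real
    using that by (rule sin_x_le_x)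
  have c2: "1 - y ^ 2 / 2 \<le> cos y" if "y \<ge> 0" for y :: real
  proof -
    define g where "g y = cos y - (1 - y ^ 2 / 2)" for y :: real
    have "g 0 \<le> g y"
      by (rule DERIV_nonneg_imp_nondecreasing[OF that])
        (auto simp: g_def s1 intro!: exI derivative_eq_intros)
    then show ?thesis by (simp add: g_def)
  qed
  have s3: "y - y ^ 3 / 6 \<le> sin y" if "y \<ge> 0" for y :: real
  proof -
    define g where "g y = sin y - (y - y ^ 3 / 6)" for y :: real
    have "g 0 \<le> g y"
    proof (rule DERIV_nonneg_imp_nondecreasing[OF that, where f = g], intro exI conjI)
      fix z :: real assume "0 \<le> z"
      show "(g has_real_derivative (cos z - (1 - z ^ 2 / 2))) (at z)"
        unfolding g_def by (auto intro!: derivative_eq_intros)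
      show "0 \<le> cos z - (1 - z ^ 2 / 2)" using c2[OF \<open>0 \<le> z\<close>] by simp
    qed
    then show ?thesis by (simp add: g_def)
  qed
  have c4: "cos y \<le> 1 - y ^ 2 / 2 + y ^ 4 / 24" if "y \<ge> 0" for y :: real
  proof -
    define g where "g y = 1 - y ^ 2 / 2 + y ^ 4 / 24 - cos y" for y :: real
    have "g 0 \<le> g y"
    proof (rule DERIV_nonneg_imp_nondecreasing[OF that, where f = g], intro exI conjI)
      fix z :: real assume "0 \<le> z"
      show "(g has_real_derivative (sin z - (z - z ^ 3 / 6))) (at z)"
        unfolding g_def by (auto intro!: derivative_eq_intros)
      show "0 \<le> sin z - (z - z ^ 3 / 6)" using s3[OF \<open>0 \<le> z\<close>] by simp
    qed
    then show ?thesis by (simp add: g_def)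
  qed
  have s5: "sin y \<le> y - y ^ 3 / 6 + y ^ 5 / 120" if "y \<ge> 0" for y :: real
  proof -
    define g where "g y = y - y ^ 3 / 6 + y ^ 5 / 120 - sin y" for y :: real
    have "g 0 \<le> g y"
    proof (rule DERIV_nonneg_imp_nondecreasing[OF that, where f = g], intro exI conjI)
      fix z :: real assume "0 \<le> z"
      show "(g has_real_derivative (1 - z ^ 2 / 2 + z ^ 4 / 24 - cos z)) (at z)"
        unfolding g_def by (auto intro!: derivative_eq_intros)
      show "0 \<le> 1 - z ^ 2 / 2 + z ^ 4 / 24 - cos z" using c4[OF \<open>0 \<le> z\<close>] by simp
    qed
    then show ?thesis by (simp add: g_def)
  qed
  have c6: "1 - y ^ 2 / 2 + y ^ 4 / 24 - y ^ 6 / 720 \<le> cos y" if "y \<ge> 0" for y :: real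
  proof -
    define g where "g y = cos y - (1 - y ^ 2 / 2 + y ^ 4 / 24 - y ^ 6 / 720)" for y :: real
    have "g 0 \<le> g y"
    proof (rule DERIV_nonneg_imp_nondecreasing[OF that, where f = g], intro exI conjI)
      fix z :: real assume "0 \<le> z"
      show "(g has_real_derivative (z - z ^ 3 / 6 + z ^ 5 / 120 - sin z)) (at z)"
        unfolding g_def by (auto intro!: derivative_eq_intros)
      show "0 \<le> z - z ^ 3 / 6 + z ^ 5 / 120 - sin z" using s5[OF \<open>0 \<le> z\<close>] by simp
    qed
    then show ?thesis by (simp add: g_def)
  qed
  show "cos x \<le> 1 - x ^ 2 / 2 + x ^ 4 / 24" using c4[of "\<bar>x\<bar>"] by simp
  show "1 - x ^ 2 / 2 + x ^ 4 / 24 - x ^ 6 / 720 \<le> cos x" using c6[of "\<bar>x\<bar>"] by simp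
qed

lemma exp_minus_taylor_upper:
  assumes "(y::real) \<ge> 0"
  shows "exp (- y) \<le> 1 - y + y ^ 2 / 2 - y ^ 3 / 6 + y ^ 4 / 24"
proof -
  have e1: "1 - y \<le> exp (- y)" for y :: real using exp_ge_add_one_self[of "- y"] by simp
  have e2: "exp (- y) \<le> 1 - y + y ^ 2 / 2" if "y \<ge> 0" for y :: real
  proof -
    define g where "g y = 1 - y + y ^ 2 / 2 - exp (- y)" for y :: real
    have "g 0 \<le> g y"
    proof (rule DERIV_nonneg_imp_nondecreasing[OF that, where f = g], intro exI conjI)
      fix z :: real assume "0 \<le> z"
      show "(g has_real_derivative exp (- z) - (1 - z)) (at z)"
        unfolding g_def by (auto intro!: derivative_eq_intros)
      show "0 \<le> exp (- z) - (1 - z)" using e1[of z] by simp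
    qed
    then show ?thesis by (simp add: g_def)
  qed
  have e3: "1 - y + y ^ 2 / 2 - y ^ 3 / 6 \<le> exp (- y)" if "y \<ge> 0" for y :: real
  proof -
    define g where "g y = exp (- y) - (1 - y + y ^ 2 / 2 - y ^ 3 / 6)" for y :: real
    have "g 0 \<le> g y"
    proof (rule DERIV_nonneg_imp_nondecreasing[OF that, where f = g], intro exI conjI)
      fix z :: real assume "0 \<le> z"
      show "(g has_real_derivative 1 - z + z ^ 2 / 2 - exp (- z)) (at z)"
        unfolding g_def by (auto intro!: derivative_eq_intros)
      show "0 \<le> 1 - z + z ^ 2 / 2 - exp (- z)" using e2[OF \<open>0 \<le> z\<close>] by simp
    qed
    then show ?thesis by (simp add: g_def)
  qed
  define g where "g y = 1 - y + y ^ 2 / 2 - y ^ 3 / 6 + y ^ 4 / 24 - exp (- y)" for y :: real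
  have "g 0 \<le> g y"
  proof (rule DERIV_nonneg_imp_nondecreasing[OF assms, where f = g], intro exI conjI)
    fix z :: real assume "0 \<le> z"
    show "(g has_real_derivative exp (- z) - (1 - z + z ^ 2 / 2 - z ^ 3 / 6)) (at z)"
      unfolding g_def by (auto intro!: derivative_eq_intros)
    show "0 \<le> exp (- z) - (1 - z + z ^ 2 / 2 - z ^ 3 / 6)" using e3[OF \<open>0 \<le> z\<close>] by simp
  qed
  then show ?thesis by (simp add: g_def)
qed

lemma exp_1_ge: "exp (1::real) \<ge> 5 / 2"
  using exp_lower_Taylor_quadratic[of "1::real"] by simp

text \<open>A single cosine, where \<open>\<sigma> = b^2/sqrt 3\<close>. Up to \<open>b^2 = 6\<close> the Taylor polynomials of both sides agree
  to second order in \<open>b^2\<close> and the third order decides; beyond that, \<open>cos b \<ge> - 1\<close> suffices.\<close>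

lemma cos_ge_exp_single:
  fixes b :: real
  shows "exp (- (b ^ 2 / sqrt 3) / 2) - (b ^ 2 - b ^ 2 / sqrt 3) / 2 \<le> cos b"
proof -
  define x where "x = b ^ 2"
  (* The exponent on the left is - l * x, and l ^ 2 = 1 / 12 makes the quadratic terms cancel. *)
  define l where "l = 1 / (2 * sqrt 3)"
  have "x \<ge> 0" by (simp add: x_def)
  have l2: "l ^ 2 = 1 / 12" "l > 0" by (simp_all add: l_def power_divide power_mult_distrib)
  have l1: "2 / 7 \<le> l"
    by (rule power2_le_imp_le) (use l2 in \<open>auto simp: power_divide\<close>)
  have l1': "l \<le> 29 / 100"
    by (rule power2_le_imp_le) (use l2 in \<open>auto simp: power_divide\<close>)
  have goal: "exp (- (l * x)) - (1 / 2 - l) * x \<le> cos b"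
  proof (cases "x \<le> 6")
    case True
    have l34: "l ^ 3 = l / 12" "l ^ 4 = 1 / 144"
    proof -
      have "l ^ 3 = l ^ 2 * l" "l ^ 4 = l ^ 2 * l ^ 2" by (simp_all add: eval_nat_numeral)
      then show "l ^ 3 = l / 12" "l ^ 4 = 1 / 144" unfolding l2(1) by simp_all
    qed
    have "exp (- (l * x)) \<le> 1 - l * x + (l * x) ^ 2 / 2 - (l * x) ^ 3 / 6 + (l * x) ^ 4 / 24"
      using \<open>x \<ge> 0\<close> l2 by (intro exp_minus_taylor_upper) auto
    also have "\<dots> = 1 - l * x + x ^ 2 / 24 - l / 72 * x ^ 3 + x ^ 4 / 3456"
      unfolding power_mult_distrib l34 l2(1) by simp
    also have "\<dots> \<le> (1 - x / 2 + x ^ 2 / 24 - x ^ 3 / 720) + (1 / 2 - l) * x"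
    proof -
      have "0 \<le> x ^ 3 * (l / 72 - 1 / 720 - x / 3456)"
        using True \<open>x \<ge> 0\<close> l1 by (intro mult_nonneg_nonneg) auto
      then show ?thesis by (simp add: algebra_simps power3_eq_cube power4_eq_xxxx)
    qed
    finally have "exp (- (l * x)) \<le> (1 - x / 2 + x ^ 2 / 24 - x ^ 3 / 720) + (1 / 2 - l) * x" .
    moreover have "(1 - x / 2 + x ^ 2 / 24 - x ^ 3 / 720) \<le> cos b"
      using cos_taylor_lower[of b] by (simp add: x_def flip: power_mult)
    ultimately show ?thesis by argo
  next
    case False
    have "exp (- (l * x)) \<le> 1 / 4"
    proof -
      have "2 / 7 * 6 \<le> l * x" using False l1 by (intro mult_mono) auto
      have "(4::real) \<le> 5 / 2 * (13 / 8)" by simp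
      also have "\<dots> \<le> exp 1 * exp (1 / 2)"
        using exp_1_ge exp_lower_Taylor_quadratic[of "1 / 2 :: real"]
        by (intro mult_mono) (auto simp: power2_eq_square)
      also have "\<dots> \<le> exp (l * x)"
        unfolding exp_add[symmetric] using \<open>2 / 7 * 6 \<le> l * x\<close> by simp
      finally show ?thesis by (simp add: exp_minus field_simps)
    qed
    moreover have "(1 / 2 - l) * x \<ge> (1 / 2 - 29 / 100) * 6"
      using False l1' by (intro mult_mono) auto
    ultimately show ?thesis using cos_ge_minus_one[of b] by argo
  qed
  then show ?thesis by (simp add: x_def l_def field_simps)
qed

text \<open>A single cosine next to an independent Gaussian part of variance \<open>v\<close>. With \<open>T = v + b^2\<close> and
  \<open>\<sigma>\<close> a function of \<open>T\<close>, multiplying by \<open>exp (T/2)\<close> leaves the cosine term independent of \<open>T\<close>, and the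
  remaining function \<open>f\<close> is increasing in \<open>T\<close>, because its derivative has the sign of
  \<open>(\<sigma>/2 - 1) * exp (\<sigma>/2) + 1 \<ge> 0\<close>. So the worst case is \<open>v = 0\<close>.\<close>

lemma cos_ge_exp_with_variance:
  fixes b v \<sigma> :: real
  assumes "v \<ge> 0" "\<sigma> \<ge> 0" "\<sigma> ^ 2 = (v + b ^ 2) ^ 2 - 2 / 3 * b ^ 4"
  shows "exp (- \<sigma> / 2) - (v + b ^ 2 - \<sigma>) / 2 \<le> exp (- v / 2) * cos b"
proof (cases "b = 0")
  case True
  then have "\<sigma> = v" using assms by (simp add: power2_eq_iff_nonneg)
  then show ?thesis using True by simp
next
  case False
  define x where "x = b ^ 2"
  have "x > 0" using False by (simp add: x_def)
  define s where "s T = sqrt (T ^ 2 - 2 / 3 * x ^ 2)" for T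
  define f where "f T = (T - s T) / 2 * exp (T / 2) - exp ((T - s T) / 2)" for T
  have spos: "T ^ 2 - 2 / 3 * x ^ 2 > 0" if "x \<le> T" for T
  proof -
    have "x ^ 2 \<le> T ^ 2" using that \<open>x > 0\<close> by (intro power_mono) auto
    moreover have "x ^ 2 > 0" using \<open>x > 0\<close> by simp
    ultimately show ?thesis by argo
  qed
  have f_mono: "f x \<le> f (v + x)"
  proof (rule DERIV_nonneg_imp_nondecreasing[where f = f])
    show "x \<le> v + x" using assms by simp
    fix T assume "x \<le> T" "T \<le> v + x"
    have "s T > 0" "s T \<le> T"
      using spos[OF \<open>x \<le> T\<close>] \<open>x \<le> T\<close> \<open>x > 0\<close> unfolding s_def by (auto intro: real_le_lsqrt)
    define D where "D = (T - s T) / 2"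
    have "D \<ge> 0" using \<open>s T \<le> T\<close> by (simp add: D_def)
    have ds: "(s has_real_derivative T / s T) (at T)"
      unfolding s_def using spos[OF \<open>x \<le> T\<close>]
      by (auto intro!: derivative_eq_intros simp: field_simps)
    have "(f has_real_derivative (1 - T / s T) / 2 * exp (T / 2) + D * (exp (T / 2) / 2)
        - exp D * ((1 - T / s T) / 2)) (at T)"
      unfolding f_def D_def
      by (auto intro!: derivative_eq_intros ds) (simp add: algebra_simps add_divide_distrib diff_divide_distrib)
    moreover have "(1 - T / s T) / 2 = - D / s T"
      using \<open>s T > 0\<close> by (simp add: D_def field_simps)
    moreover have "- D / s T * exp (T / 2) + D * (exp (T / 2) / 2) - exp D * (- D / s T)
      = D * exp D * ((s T / 2 - 1) * exp (s T / 2) + 1) / s T"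
    proof -
      have "exp (T / 2) = exp D * exp (s T / 2)"
        unfolding exp_add[symmetric] D_def by (simp add: field_simps)
      then show ?thesis using \<open>s T > 0\<close> by (simp add: field_simps)
    qed
    moreover have "(s T / 2 - 1) * exp (s T / 2) + 1 \<ge> 0"
    proof -
      have "exp (s T / 2) * (1 - s T / 2) \<le> exp (s T / 2) * exp (- (s T / 2))"
        using exp_ge_add_one_self[of "- (s T / 2)"] by (intro mult_left_mono) auto
      then show ?thesis by (simp add: exp_minus algebra_simps)
    qed
    ultimately show "\<exists>y. (f has_real_derivative y) (at T) \<and> 0 \<le> y"
      using \<open>s T > 0\<close> \<open>D \<ge> 0\<close> by (intro exI[of _ "D * exp D * ((s T / 2 - 1) * exp (s T / 2) + 1) / s T"]) auto
  qed
  have sv: "s (v + x) = \<sigma>"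
  proof -
    have "(v + x) ^ 2 - 2 / 3 * x ^ 2 = \<sigma> ^ 2" by (simp add: assms(3) x_def flip: power_mult)
    then show ?thesis using assms(2) by (simp only: s_def real_sqrt_abs)
  qed
  have sx: "s x = x / sqrt 3"
    using \<open>x > 0\<close> by (simp add: s_def real_sqrt_divide real_sqrt_mult)
  have "- exp (x / 2) * cos b \<le> f x"
  proof -
    have "exp (x / 2) * (exp (- s x / 2) - (x - s x) / 2) \<le> exp (x / 2) * cos b"
      using cos_ge_exp_single[of b] by (intro mult_left_mono) (simp_all add: sx flip: x_def)
    moreover have "exp (x / 2) * exp (- s x / 2) = exp ((x - s x) / 2)"
      unfolding exp_add[symmetric] by (simp add: diff_divide_distrib)
    ultimately show ?thesis by (simp add: f_def algebra_simps add_divide_distrib diff_divide_distrib)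
  qed
  then have "- exp (x / 2) * cos b \<le> f (v + x)" using f_mono by simp
  then have "exp (- (v + x) / 2) * (- exp (x / 2) * cos b) \<le> exp (- (v + x) / 2) * f (v + x)"
    by (intro mult_left_mono) auto
  moreover have "exp (- (v + x) / 2) * (- exp (x / 2) * cos b) = - (exp (- v / 2) * cos b)"
  proof -
    have "exp (- (v + x) / 2) * exp (x / 2) = exp (- v / 2)"
      unfolding exp_add[symmetric] by (simp add: field_simps)
    then show ?thesis by simp
  qed
  moreover have "exp (- (v + x) / 2) * f (v + x) = (v + x - \<sigma>) / 2 - exp (- \<sigma> / 2)"
  proof -
    have "exp (- (v + x) / 2) * exp ((v + x) / 2) = 1"
      "exp (- (v + x) / 2) * exp ((v + x - \<sigma>) / 2) = exp (- \<sigma> / 2)"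
      unfolding exp_add[symmetric] by (simp_all add: field_simps)
    then show ?thesis 
      unfolding f_def sv right_diff_distrib mult.left_commute[of "exp (- (v + x) / 2)" "(v + x - \<sigma>) / 2"] by simp
  qed
  ultimately show ?thesis unfolding x_def by linarith
qed

lemma cos_le_exp_small:
  assumes "\<bar>b\<bar> \<le> pi / 2"
  shows "cos b \<le> exp (- (b ^ 2) / 2)"
proof -
  have sc: "y * cos y \<le> sin y" if "0 \<le> y" "y \<le> pi" for y :: real
  proof -
    define g where "g y = sin y - y * cos y" for y :: real
    have "g 0 \<le> g y"
    proof (rule DERIV_nonneg_imp_nondecreasing[OF that(1), where f = g], intro exI conjI)
      fix z :: real assume "0 \<le> z" "z \<le> y"
      show "(g has_real_derivative z * sin z) (at z)"
        unfolding g_def by (auto intro!: derivative_eq_intros)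
      show "0 \<le> z * sin z" using \<open>0 \<le> z\<close> \<open>z \<le> y\<close> that by (intro mult_nonneg_nonneg sin_ge_zero) auto
    qed
    then show ?thesis by (simp add: g_def)
  qed
  define g where "g y = - (exp (y ^ 2 / 2) * cos y)" for y :: real
  have "g 0 \<le> g \<bar>b\<bar>"
  proof (rule DERIV_nonneg_imp_nondecreasing[where f = g], simp, intro exI conjI)
    fix z :: real assume "0 \<le> z" "z \<le> \<bar>b\<bar>"
    show "(g has_real_derivative exp (z ^ 2 / 2) * (sin z - z * cos z)) (at z)"
      unfolding g_def by (auto intro!: derivative_eq_intros simp: algebra_simps)
    show "0 \<le> exp (z ^ 2 / 2) * (sin z - z * cos z)"
      using sc[of z] \<open>0 \<le> z\<close> \<open>z \<le> \<bar>b\<bar>\<close> assms by (intro mult_nonneg_nonneg) auto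
  qed
  then have "exp (b ^ 2 / 2) * cos b \<le> 1" by (simp add: g_def)
  then show ?thesis by (simp add: exp_minus field_simps)
qed

lemma prod_cos_small_bounds:
  assumes "finite I" "\<And>i. i \<in> I \<Longrightarrow> \<bar>b i\<bar> \<le> pi / 2"
  shows "0 \<le> (\<Prod>i\<in>I. cos (b i))" "(\<Prod>i\<in>I. cos (b i)) \<le> exp (- (\<Sum>i\<in>I. b i ^ 2) / 2)"
proof -
  have nonneg: "0 \<le> cos (b i)" if "i \<in> I" for i
    using assms(2)[OF that] by (intro cos_ge_zero) auto
  then show "0 \<le> (\<Prod>i\<in>I. cos (b i))" by (rule prod_nonneg)
  have "(\<Prod>i\<in>I. cos (b i)) \<le> (\<Prod>i\<in>I. exp (- (b i ^ 2) / 2))"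
    using nonneg cos_le_exp_small[OF assms(2)] by (intro prod_mono) auto
  also have "\<dots> = exp (- (\<Sum>i\<in>I. b i ^ 2) / 2)"
    using assms(1) by (simp add: sum_negf sum_divide_distrib flip: exp_sum)
  finally show "(\<Prod>i\<in>I. cos (b i)) \<le> exp (- (\<Sum>i\<in>I. b i ^ 2) / 2)" .
qed

text \<open>Exchanging the factor \<open>cos b\<close> for the Gaussian factor of variance \<open>\<sigma> - v\<close> that keeps the fourth moment
  of the whole. The error is allowed by \<open>cos_ge_exp_with_variance\<close>, provided that the remaining factor
  \<open>R\<close> is dominated by the Gaussian factor of the same variance \<open>v\<close>.\<close>

lemma cos_exchange:
  fixes b v \<sigma> s R :: real
  assumes "v \<ge> 0" "\<sigma> \<ge> 0" "\<sigma> ^ 2 = (v + b ^ 2) ^ 2 - 2 / 3 * b ^ 4" "0 \<le> R" "R \<le> exp (- v / 2)"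
  shows "exp (- (\<sigma> - v) / 2) * R - (v + b ^ 2 - \<sigma>) / 2 \<le> cos b * R"
proof (cases "exp (- (\<sigma> - v) / 2) \<le> cos b")
  case True
  have "\<sigma> ^ 2 \<le> (v + b ^ 2) ^ 2" unfolding assms(3) by simp
  then have "\<sigma> \<le> v + b ^ 2" using assms by (auto intro: power2_le_imp_le)
  moreover have "exp (- (\<sigma> - v) / 2) * R \<le> cos b * R" using True assms by (intro mult_right_mono)
  ultimately show ?thesis by argo
next
  case False
  have "(exp (- (\<sigma> - v) / 2) - cos b) * R \<le> (exp (- (\<sigma> - v) / 2) - cos b) * exp (- v / 2)"
    using False assms by (intro mult_left_mono) auto
  also have "\<dots> = exp (- \<sigma> / 2) - cos b * exp (- v / 2)"
    unfolding left_diff_distrib exp_add[symmetric] by (simp add: field_simps)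
  also have "\<dots> \<le> (v + b ^ 2 - \<sigma>) / 2"
    using cos_ge_exp_with_variance[OF assms(1-3)] by argo
  finally show ?thesis unfolding left_diff_distrib by argo
qed

text \<open>One step of the replacement, from variance \<open>s\<close> of the Gaussian part and a remaining cosine \<open>cos b\<close> to
  the larger variance \<open>s' = s + (r - v)\<close>. The quantity \<open>\<sigma>\<close> is the same before and after, so the gaps
  \<open>(variance - \<sigma>)/2\<close> telescope. The exchanged angle \<open>b\<close> may be large, but
  the product \<open>P\<close> of the other cosines has to lie between zero and its Gaussian counterpart.\<close>

lemma gaussian_exchange_step:
  fixes b s \<sigma> P Y q :: real
  assumes "Y \<ge> 0" "s \<ge> 0" "0 \<le> P" "P \<le> exp (- Y / 2)" "\<sigma> \<ge> 0"
    and \<sigma>: "\<sigma> ^ 2 = (s + b ^ 2 + Y) ^ 2 - 2 / 3 * (b ^ 4 + q)"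
    and rest: "\<And>s'. s' \<ge> 0 \<Longrightarrow> \<sigma> ^ 2 = (s' + Y) ^ 2 - 2 / 3 * q \<Longrightarrow>
      exp (- \<sigma> / 2) - (s' + Y - \<sigma>) / 2 \<le> exp (- s' / 2) * P"
  shows "exp (- \<sigma> / 2) - (s + b ^ 2 + Y - \<sigma>) / 2 \<le> exp (- s / 2) * (cos b * P)"
proof -
  define v where "v = s + Y"
  have "v \<ge> 0" using assms by (simp add: v_def)
  define r where "r = sqrt ((v + b ^ 2) ^ 2 - 2 / 3 * b ^ 4)"
  have le: "v ^ 2 \<le> (v + b ^ 2) ^ 2 - 2 / 3 * b ^ 4"
  proof -
    have "0 \<le> 2 * v * b ^ 2" "0 \<le> b ^ 4" using \<open>v \<ge> 0\<close> by simp_all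
    then show ?thesis by (simp add: power2_eq_square power4_eq_xxxx algebra_simps)
  qed
  then have r2: "r ^ 2 = (v + b ^ 2) ^ 2 - 2 / 3 * b ^ 4"
    unfolding r_def using zero_le_power2[of v] by (intro real_sqrt_pow2) linarith
  have "r \<ge> 0" unfolding r_def using zero_le_power2[of v] le by (intro real_sqrt_ge_zero) linarith
  then have "v \<le> r" using le unfolding r2[symmetric] by (auto intro: power2_le_imp_le)
  define R where "R = exp (- s / 2) * P"
  have R: "0 \<le> R" "R \<le> exp (- v / 2)"
  proof -
    show "0 \<le> R" unfolding R_def using assms by simp
    have "R \<le> exp (- s / 2) * exp (- Y / 2)" 
      unfolding R_def using assms by (intro mult_left_mono) auto
    then show "R \<le> exp (- v / 2)" unfolding exp_add[symmetric] v_def by (simp add: field_simps)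
  qed
  have "s + (r - v) + Y = r" by (simp add: v_def)
  then have "exp (- \<sigma> / 2) - (s + (r - v) + Y - \<sigma>) / 2 \<le> exp (- (s + (r - v)) / 2) * P"
    using \<open>v \<le> r\<close> assms(2) by (intro rest) (auto simp: r2 \<sigma> v_def add_divide_distrib ac_simps)
  also have "exp (- (s + (r - v)) / 2) * P = exp (- (r - v) / 2) * R"
    unfolding R_def mult.assoc[symmetric] exp_add[symmetric] by (simp add: field_simps)
  also have "\<dots> \<le> cos b * R + (v + b ^ 2 - r) / 2"
    using cos_exchange[OF \<open>v \<ge> 0\<close> \<open>r \<ge> 0\<close> r2 R] by simp
  finally show ?thesis
    by (simp add: R_def v_def field_simps)
qed

text \<open>The Gaussian part \<open>s\<close> collects the factors that have already been replaced.\<close>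

lemma prod_cos_small_ge:
  assumes "finite I" "\<And>i. i \<in> I \<Longrightarrow> \<bar>b i\<bar> \<le> pi / 2" "s \<ge> 0" "\<sigma> \<ge> 0"
    "\<sigma> ^ 2 = (s + (\<Sum>i\<in>I. b i ^ 2)) ^ 2 - 2 / 3 * (\<Sum>i\<in>I. b i ^ 4)"
  shows "exp (- \<sigma> / 2) - (s + (\<Sum>i\<in>I. b i ^ 2) - \<sigma>) / 2 \<le> exp (- s / 2) * (\<Prod>i\<in>I. cos (b i))"
  using assms
proof (induction I arbitrary: s rule: finite_induct)
  case empty
  then have "\<sigma> = s" by (simp add: power2_eq_iff_nonneg)
  then show ?case by simp
next
  case (insert i I)
  have "exp (- \<sigma> / 2) - (s + b i ^ 2 + (\<Sum>i\<in>I. b i ^ 2) - \<sigma>) / 2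
    \<le> exp (- s / 2) * (cos (b i) * (\<Prod>i\<in>I. cos (b i)))"
    using insert prod_cos_small_bounds[OF insert.hyps(1), of b]
    by (intro gaussian_exchange_step[where q = "\<Sum>i\<in>I. b i ^ 4"]) (auto intro: sum_nonneg simp: add.assoc)
  then show ?case using insert.hyps by (simp add: add.assoc)
qed

lemma abs_cos_le_large:
  assumes "pi / 2 \<le> \<bar>b\<bar>"
  shows "\<bar>cos b\<bar> \<le> (b ^ 2 - 1) / 6"
proof (cases "b ^ 2 \<le> 7")
  case True
  define x where "x = b ^ 2"
  have "\<bar>b\<bar> ^ 2 \<le> 3 ^ 2" using True by simp
  then have "\<bar>b\<bar> \<le> 3" by (rule power2_le_imp_le) simp
  then have "\<bar>b\<bar> \<le> pi" using pi_gt3 by simp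
  then have "cos b \<le> 0"
    using cos_monotone_0_pi_le[of "pi / 2" "\<bar>b\<bar>"] assms by simp
  have "(pi / 2) ^ 2 \<le> \<bar>b\<bar> ^ 2" using assms by (intro power_mono) auto
  (* The Taylor bound leaves a cubic with its local maximum, a small negative number, near 11/2. *)
  have "(x - 11 / 2) ^ 2 * (x - 19) \<le> 0" using True by (intro mult_nonneg_nonpos) (auto simp: x_def)
  then have "x ^ 3 - 30 * x ^ 2 + 240 * x - 600 \<le> 0"
    using True unfolding x_def[symmetric] 
    by (simp add: power2_eq_square power3_eq_cube algebra_simps add_divide_distrib diff_divide_distrib)
  then have "- (1 - x / 2 + x ^ 2 / 24 - x ^ 3 / 720) \<le> (x - 1) / 6" by simp
  moreover have "(1 - x / 2 + x ^ 2 / 24 - x ^ 3 / 720) \<le> cos b"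
    using cos_taylor_lower[of b] by (simp add: x_def flip: power_mult)
  ultimately show ?thesis using \<open>cos b \<le> 0\<close> by (simp add: x_def)
next
  case False
  then have "1 \<le> (b ^ 2 - 1) / 6" by simp
  then show ?thesis using abs_cos_le_one[of b] by linarith
qed

lemma abs_prod_le_member:
  fixes f :: "'i \<Rightarrow> real"
  assumes "finite L" "i \<in> L" "\<And>j. j \<in> L \<Longrightarrow> \<bar>f j\<bar> \<le> 1"
  shows "\<bar>\<Prod>j\<in>L. f j\<bar> \<le> \<bar>f i\<bar>"
proof -
  have "(\<Prod>j\<in>L - {i}. \<bar>f j\<bar>) \<le> 1" using assms by (intro prod_le_1) auto
  then have "\<bar>f i\<bar> * (\<Prod>j\<in>L - {i}. \<bar>f j\<bar>) \<le> \<bar>f i\<bar> * 1" by (intro mult_left_mono) auto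
  then show ?thesis using assms by (simp add: prod.remove abs_mult abs_prod)
qed

text \<open>Here \<open>L\<close> carries the large angles, \<open>P\<close> is the product of the small cosines with total variance \<open>Y\<close>,
  and \<open>D\<close> stands for the gap \<open>(V - \<sigma>)/2\<close>. If the product is nonnegative, the lower bound on the gap, at
  least of order \<open>1/(B + Y)\<close>, beats the exponential. If it is negative, then \<open>B \<ge> 27/4\<close>: otherwise there would be just two large angles,
  both below \<open>pi\<close>, with cosines of the same sign. The product of the large cosines is at most each of them in
  absolute value, hence at most their average with weights \<open>(b i)^2/B\<close>, and \<open>abs_cos_le_large\<close>
  compares this average with \<open>D\<close>.\<close>

lemma prod_cos_ge_two_large:
  fixes b :: "'i \<Rightarrow> real"
  assumes fin: "finite L" and two: "2 \<le> card L" and large: "\<And>i. i \<in> L \<Longrightarrow> pi / 2 < \<bar>b i\<bar>"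
  defines "B \<equiv> (\<Sum>i\<in>L. b i ^ 2)"
  assumes Y: "Y \<ge> 0" and P: "0 \<le> P" "P \<le> exp (- Y / 2)"
    and \<sigma>: "\<sigma> \<ge> 0" "4 / 7 * (B + Y) \<le> \<sigma>" 
    and D: "6 * (B + Y) * D \<ge> (\<Sum>i\<in>L. b i ^ 4)"
  shows "exp (- \<sigma> / 2) - D \<le> (\<Prod>i\<in>L. cos (b i)) * P"
proof -
  define g where "g = (\<Prod>i\<in>L. cos (b i))"
  define Q where "Q = (\<Sum>i\<in>L. b i ^ 4)"
  have x: "9 / 4 \<le> b i ^ 2" if "i \<in> L" for i
  proof -
    have "(3 / 2) ^ 2 \<le> \<bar>b i\<bar> ^ 2" using large[OF that] pi_gt3 by (intro power_mono) auto
    then show ?thesis by (simp add: power2_eq_square)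
  qed
  have "of_nat (card L) * (9 / 4) \<le> B" unfolding B_def using x by (rule sum_bounded_below)
  then have B: "9 / 2 \<le> B" using two by simp
  have "9 / 4 * B \<le> Q"
    unfolding B_def Q_def sum_distrib_left
  proof (rule sum_mono)
    fix i assume "i \<in> L"
    then have "9 / 4 * b i ^ 2 \<le> b i ^ 2 * b i ^ 2" using x by (intro mult_right_mono) auto
    then show "9 / 4 * b i ^ 2 \<le> b i ^ 4" by (simp flip: power_add)
  qed
  define X where "X = B + Y"
  have X: "X > 0" "B \<le> X" using B Y by (auto simp: X_def)
  have D': "Q / (6 * X) \<le> D" using D X by (simp add: Q_def X_def field_simps)
  have e: "exp (- \<sigma> / 2) \<le> exp (- (2 / 7 * X))" using \<sigma> by (simp add: X_def)
  show ?thesis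
  proof (cases "g * P \<ge> 0")
    case True
    have "5 / 2 * (2 / 7 * X) \<le> exp 1 * exp (2 / 7 * X - 1)"
      using exp_1_ge X exp_ge_add_one_self[of "2 / 7 * X - 1"] by (intro mult_mono) auto
    then have "5 / 7 * X \<le> exp (2 / 7 * X)" unfolding exp_add[symmetric] by simp
    then have "exp (- (2 / 7 * X)) \<le> 7 / (5 * X)" using X by (simp add: exp_minus field_simps)
    also have "\<dots> \<le> Q / (6 * X)"
      using \<open>9 / 4 * B \<le> Q\<close> B X by (simp add: field_simps)
    finally show ?thesis using True D' e unfolding g_def by linarith
  next
    case False
    then have "g < 0" using P by (auto simp: not_le mult_less_0_iff)
    have B': "27 / 4 \<le> B"
    proof (rule ccontr)
      assume "\<not> 27 / 4 \<le> B"
      with \<open>of_nat (card L) * (9 / 4) \<le> B\<close> have "real (card L) < 3" by simp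
      then have "card L = 2" using two by simp
      then obtain i j where L: "L = {i, j}" "i \<noteq> j" by (auto simp: card_2_iff)
      have "cos (b k) \<le> 0" if "k \<in> L" for k
      proof -
        have "b k ^ 2 \<le> B" unfolding B_def using fin that by (intro member_le_sum) auto
        then have "\<bar>b k\<bar> ^ 2 \<le> 3 ^ 2" using \<open>\<not> 27 / 4 \<le> B\<close> by simp
        then have "\<bar>b k\<bar> \<le> 3" by (rule power2_le_imp_le) simp
        then have "\<bar>b k\<bar> \<le> pi" using pi_gt3 by simp
        then show "cos (b k) \<le> 0"
          using cos_monotone_0_pi_le[of "pi / 2" "\<bar>b k\<bar>"] large[OF that] by simp
      qed
      then have "g \<ge> 0" unfolding g_def L using L(2) by (simp add: L(1) mult_nonpos_nonpos)
      with \<open>g < 0\<close> show False by simp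
    qed
    have "B * \<bar>g\<bar> \<le> (Q - B) / 6"
    proof -
      have "B * \<bar>g\<bar> \<le> (\<Sum>i\<in>L. b i ^ 2 * ((b i ^ 2 - 1) / 6))"
        unfolding B_def sum_distrib_right
      proof (intro sum_mono mult_left_mono)
        fix i assume "i \<in> L"
        have "\<bar>g\<bar> \<le> \<bar>cos (b i)\<bar>"
          unfolding g_def using fin \<open>i \<in> L\<close> by (rule abs_prod_le_member) simp
        also have "\<dots> \<le> (b i ^ 2 - 1) / 6" using large[OF \<open>i \<in> L\<close>] by (intro abs_cos_le_large) simp
        finally show "\<bar>g\<bar> \<le> (b i ^ 2 - 1) / 6" .
      qed simp
      also have "\<dots> = (Q - B) / 6"
        unfolding Q_def B_def sum_subtractf[symmetric] sum_divide_distrib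
        by (intro sum.cong refl) (simp add: algebra_simps flip: power_add)
      finally show ?thesis .
    qed
    then have "(6 * (B * \<bar>g\<bar>) + B) / (6 * X) \<le> Q / (6 * X)"
      using X by (intro divide_right_mono) auto
    then have "(\<bar>g\<bar> + 1 / 6) * (B / X) \<le> Q / (6 * X)"
      using X by (simp add: add_divide_distrib algebra_simps)
    moreover have "(\<bar>g\<bar> + 1 / 6) * exp (- Y / 4) \<le> (\<bar>g\<bar> + 1 / 6) * (B / X)"
    proof (rule mult_left_mono)
      have "X \<le> B * (1 + Y / 4)" using B Y mult_right_mono[of 4 B Y] by (simp add: X_def field_simps)
      also have "\<dots> \<le> B * exp (Y / 4)" using B by (intro mult_left_mono exp_ge_add_one_self) auto
      finally show "exp (- Y / 4) \<le> B / X" using X by (simp add: exp_minus field_simps)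
    qed simp
    moreover have "exp (- (2 / 7 * X)) \<le> 1 / 6 * exp (- Y / 4)"
    proof -
      have "(6::real) \<le> (1 + 9 / 14 + (9 / 14) ^ 2 / 2) ^ 3" by (simp add: eval_nat_numeral)
      also have "\<dots> \<le> exp (9 / 14) ^ 3"
        by (intro power_mono exp_lower_Taylor_quadratic) auto
      also have "\<dots> = exp (27 / 14)" by (simp flip: exp_of_nat_mult)
      also have "\<dots> \<le> exp (2 / 7 * B)" using B' by simp
      finally have "exp (- (2 / 7 * B)) \<le> 1 / 6" by (simp add: exp_minus field_simps)
      moreover have "exp (- (2 / 7 * Y)) \<le> exp (- Y / 4)" using Y by simp
      ultimately have "exp (- (2 / 7 * B)) * exp (- (2 / 7 * Y)) \<le> 1 / 6 * exp (- Y / 4)"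
        by (intro mult_mono) auto
      then show ?thesis unfolding exp_add[symmetric] by (simp add: X_def algebra_simps add_divide_distrib)
    qed
    moreover have "\<bar>g\<bar> * P \<le> \<bar>g\<bar> * exp (- Y / 4)"
    proof (rule mult_left_mono)
      have "exp (- Y / 2) \<le> exp (- Y / 4)" using Y by simp
      with P show "P \<le> exp (- Y / 4)" by linarith
    qed simp
    ultimately have "\<bar>g\<bar> * P + exp (- \<sigma> / 2) \<le> D"
      using e D' unfolding distrib_right by linarith
    moreover have "g * P = - (\<bar>g\<bar> * P)" using \<open>g < 0\<close> by simp
    ultimately show ?thesis unfolding g_def[symmetric] by linarith
  qed
qed

text \<open>If there is exactly one large angle, it has to be exchanged first, since the remaining cosines must be
  nonnegative and below their Gaussian counterparts.\<close>

lemma prod_cos_ge: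
  fixes b :: "'i \<Rightarrow> real"
  assumes fin: "finite I" and "\<sigma> \<ge> 0" 
    and \<sigma>: "\<sigma> ^ 2 = (\<Sum>i\<in>I. b i ^ 2) ^ 2 - 2 / 3 * (\<Sum>i\<in>I. b i ^ 4)"
  shows "exp (- \<sigma> / 2) - ((\<Sum>i\<in>I. b i ^ 2) - \<sigma>) / 2 \<le> (\<Prod>i\<in>I. cos (b i))"
proof -
  define L where "L = {i \<in> I. pi / 2 < \<bar>b i\<bar>}"
  define S where "S = I - L"
  have fins: "finite L" "finite S" and I: "I = L \<union> S" "L \<inter> S = {}" 
    using fin by (auto simp: L_def S_def)
  have small: "\<bar>b i\<bar> \<le> pi / 2" if "i \<in> S" for i using that by (auto simp: S_def L_def)
  have split: "(\<Sum>i\<in>I. f i) = (\<Sum>i\<in>L. f i) + (\<Sum>i\<in>S. f i)" for f :: "'i \<Rightarrow> real"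
    unfolding I(1) using fins I(2) by (rule sum.union_disjoint)
  have split_prod: "(\<Prod>i\<in>I. f i) = (\<Prod>i\<in>L. f i) * (\<Prod>i\<in>S. f i)" for f :: "'i \<Rightarrow> real"
    unfolding I(1) using fins I(2) by (rule prod.union_disjoint)
  note bounds = prod_cos_small_bounds[OF fins(2) small]
  consider "card L = 0" | "card L = 1" | "2 \<le> card L" by linarith
  then show ?thesis
  proof cases
    case 1
    then have "S = I" using fins I by simp
    then show ?thesis
      using prod_cos_small_ge[OF fins(2) small, where s = 0 and \<sigma> = \<sigma>] \<sigma> \<open>\<sigma> \<ge> 0\<close> by simp
  next
    case 2
    then obtain i where L: "L = {i}" by (auto simp: card_1_singleton_iff)
    have "exp (- \<sigma> / 2) - (0 + b i ^ 2 + (\<Sum>i\<in>S. b i ^ 2) - \<sigma>) / 2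
      \<le> exp (- 0 / 2) * (cos (b i) * (\<Prod>i\<in>S. cos (b i)))"
    proof (rule gaussian_exchange_step[where q = "\<Sum>i\<in>S. b i ^ 4"])
      show "\<sigma> ^ 2 = (0 + b i ^ 2 + (\<Sum>i\<in>S. b i ^ 2)) ^ 2 - 2 / 3 * (b i ^ 4 + (\<Sum>i\<in>S. b i ^ 4))"
        unfolding \<sigma> split by (simp add: L)
      show "exp (- \<sigma> / 2) - (s' + (\<Sum>i\<in>S. b i ^ 2) - \<sigma>) / 2 \<le> exp (- s' / 2) * (\<Prod>i\<in>S. cos (b i))"
        if "s' \<ge> 0" "\<sigma> ^ 2 = (s' + (\<Sum>i\<in>S. b i ^ 2)) ^ 2 - 2 / 3 * (\<Sum>i\<in>S. b i ^ 4)" for s'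
        using prod_cos_small_ge[OF fins(2) small that(1) \<open>\<sigma> \<ge> 0\<close> that(2)] .
    qed (use bounds \<open>\<sigma> \<ge> 0\<close> in \<open>auto intro: sum_nonneg\<close>)
    then show ?thesis unfolding split split_prod by (simp add: L)
  next
    case 3
    define X where "X = (\<Sum>i\<in>I. b i ^ 2)"
    define Q where "Q = (\<Sum>i\<in>I. b i ^ 4)"
    have "X \<ge> 0" by (simp add: X_def sum_nonneg)
    have "Q \<le> X ^ 2"
    proof -
      have "Q \<le> (\<Sum>i\<in>I. b i ^ 2 * X)"
        unfolding Q_def
      proof (rule sum_mono)
        fix i assume "i \<in> I"
        then have "b i ^ 2 * b i ^ 2 \<le> b i ^ 2 * X"
          unfolding X_def using fin by (intro mult_left_mono member_le_sum) auto
        then show "b i ^ 4 \<le> b i ^ 2 * X" by (simp flip: power_add)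
      qed
      then show ?thesis by (simp add: X_def power2_eq_square flip: sum_distrib_right)
    qed
    have \<sigma>': "\<sigma> ^ 2 = X ^ 2 - 2 / 3 * Q" by (simp add: \<sigma> X_def Q_def)
    have "Q \<ge> 0" by (simp add: Q_def sum_nonneg)
    have "\<sigma> ^ 2 \<le> X ^ 2" using \<sigma>' \<open>Q \<ge> 0\<close> by simp
    then have "\<sigma> \<le> X" using \<open>X \<ge> 0\<close> by (rule power2_le_imp_le)
    have "(4 / 7 * X) ^ 2 \<le> \<sigma> ^ 2"
    proof -
      have "(4 / 7 * X) ^ 2 = 16 / 49 * X ^ 2" by (simp add: power_mult_distrib power_divide)
      then show ?thesis unfolding \<sigma>' using \<open>Q \<le> X ^ 2\<close> zero_le_power2[of X] by linarith
    qed
    then have "4 / 7 * X \<le> \<sigma>" using \<open>\<sigma> \<ge> 0\<close> by (rule power2_le_imp_le)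
    have "Q \<le> 6 * X * ((X - \<sigma>) / 2)"
    proof -
      have "2 / 3 * Q = (X - \<sigma>) * (X + \<sigma>)" using \<sigma>' by (simp add: algebra_simps power2_eq_square)
      also have "\<dots> \<le> (X - \<sigma>) * (2 * X)" using \<open>\<sigma> \<le> X\<close> by (intro mult_left_mono) auto
      finally show ?thesis by (simp add: algebra_simps)
    qed
    have XLS: "X = (\<Sum>i\<in>L. b i ^ 2) + (\<Sum>i\<in>S. b i ^ 2)" unfolding X_def by (rule split)
    have "exp (- \<sigma> / 2) - (X - \<sigma>) / 2 \<le> (\<Prod>i\<in>L. cos (b i)) * (\<Prod>i\<in>S. cos (b i))"
    proof (rule prod_cos_ge_two_large[where Y = "\<Sum>i\<in>S. b i ^ 2"])
      have "(\<Sum>i\<in>L. b i ^ 4) \<le> Q" unfolding Q_def split by (simp add: sum_nonneg)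
      with \<open>Q \<le> 6 * X * ((X - \<sigma>) / 2)\<close>
      show "(\<Sum>i\<in>L. b i ^ 4) \<le> 6 * ((\<Sum>i\<in>L. b i ^ 2) + (\<Sum>i\<in>S. b i ^ 2)) * ((X - \<sigma>) / 2)"
        unfolding XLS[symmetric] by linarith
    qed (use fins 3 bounds \<open>4 / 7 * X \<le> \<sigma>\<close> \<open>\<sigma> \<ge> 0\<close> XLS in \<open>auto simp: L_def intro: sum_nonneg\<close>)
    then show ?thesis by (simp add: split_prod X_def)
  qed
qed

section \<open>Gaussian moments\<close>

definition gauss_moment :: "real \<Rightarrow> real" where
  "gauss_moment p = (\<integral>x. \<bar>x\<bar> powr p \<partial>std_normal_distribution)"

lemma integrable_gauss_moment:
  assumes "p \<ge> 0"
  shows "integrable std_normal_distribution (\<lambda>x. \<bar>x\<bar> powr p)"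
proof -
  interpret N: prob_space std_normal_distribution
    by (rule prob_space_normal_density) simp
  define k where "k = nat \<lceil>p\<rceil>"
  show ?thesis
  proof (rule Bochner_Integration.integrable_bound)
    show "integrable std_normal_distribution (\<lambda>x. 1 + x ^ (2 * k))"
      using integrable_std_normal_distribution_moment[of "2 * k"] by simp
    show "AE x in std_normal_distribution. norm (\<bar>x\<bar> powr p) \<le> norm (1 + x ^ (2 * k))"
    proof (intro AE_I2)
      fix x :: real
      have "\<bar>x\<bar> powr p \<le> 1 + x ^ (2 * k)"
      proof (cases "\<bar>x\<bar> \<le> 1")
        case True
        then have "\<bar>x\<bar> powr p \<le> 1" using assms by (simp add: powr_le1)
        moreover have "0 \<le> x ^ (2 * k)" by (simp add: power_mult)
        ultimately show ?thesis by linarith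
      next
        case False
        then have "\<bar>x\<bar> powr p \<le> \<bar>x\<bar> powr real (2 * k)"
          using assms by (intro powr_mono) (auto simp: k_def, linarith)
        also have "\<dots> = \<bar>x\<bar> ^ (2 * k)" using False by (subst powr_realpow) auto
        also have "\<dots> = x ^ (2 * k)" by (simp add: power_even_abs)
        finally show ?thesis by simp
      qed
      moreover have "0 \<le> x ^ (2 * k)" by (simp add: power_mult)
      ultimately show "norm (\<bar>x\<bar> powr p) \<le> norm (1 + x ^ (2 * k))" by simp
    qed
  qed simp
qed

lemma gauss_moment_nonneg: "gauss_moment p \<ge> 0"
  by (simp add: gauss_moment_def)

lemma abs_powr_4: "\<bar>x\<bar> powr 4 = (x::real) ^ 4"
proof (cases "x = 0")
  case False
  have "\<bar>x\<bar> powr real 4 = \<bar>x\<bar> ^ 4" using False by (intro powr_realpow) simp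
  then show ?thesis by simp
qed simp

lemma gauss_moment_4: "gauss_moment 4 = 3"
  using std_normal_distribution_even_moments(1)[of 2]
  by (simp add: gauss_moment_def abs_powr_4 fact_numeral)

text \<open>Integration by parts: \<open>f\<close> is the derivative of \<open>F\<close>, which vanishes at both ends.\<close>

lemma gauss_moment_rec:
  assumes "p \<ge> 4"
  shows "gauss_moment p = (p - 1) * gauss_moment (p - 2)"
proof -
  define f where "f x = ((p - 1) * \<bar>x\<bar> powr (p - 2) - \<bar>x\<bar> powr p) * std_normal_density x" for x
  define F where "F x = signed_powr (p - 1) x * std_normal_density x" for x
  have dens: "(std_normal_density has_real_derivative - x * std_normal_density x) (at x)" for x
  proof -
    have "((\<lambda>x. exp (- x\<^sup>2 / 2)) has_real_derivative - x * exp (- x\<^sup>2 / 2)) (at x)"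
      by (auto intro!: derivative_eq_intros)
    from DERIV_cmult[OF this, of "1 / sqrt (2 * pi)"] show ?thesis
      unfolding std_normal_density_def by (simp add: mult.commute)
  qed
  have F: "(F has_real_derivative f x) (at x)" for x
  proof -
    have "(F has_real_derivative (p - 1) * \<bar>x\<bar> powr (p - 2) * std_normal_density x
       + (- x * std_normal_density x) * signed_powr (p - 1) x) (at x)"
      unfolding F_def using DERIV_mult[OF DERIV_signed_powr[of "p - 1" x] dens[of x]] assms by simp
    also have "(- x * std_normal_density x) * signed_powr (p - 1) x = - (x * signed_powr (p - 1) x) * std_normal_density x"
      by simp
    finally show ?thesis
      unfolding mult_signed_powr f_def by (simp add: algebra_simps)
  qed
  have int: "integrable std_normal_distribution (\<lambda>x. (p - 1) * \<bar>x\<bar> powr (p - 2) - \<bar>x\<bar> powr p)"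
    using assms integrable_gauss_moment[of p] integrable_gauss_moment[of "p - 2"] by simp
  then have f_int: "integrable lborel f"
    by (subst (asm) integrable_density) (auto simp: f_def[abs_def] mult.commute)
  have top: "(F \<longlongrightarrow> 0) at_top"
  proof -
    have "((\<lambda>x. x powr (p - 1) * (1 / sqrt (2 * pi) * exp (- x\<^sup>2 / 2))) \<longlongrightarrow> 0) at_top"
      by real_asymp
    moreover have "\<forall>\<^sub>F x in at_top. x powr (p - 1) * (1 / sqrt (2 * pi) * exp (- x\<^sup>2 / 2)) = F x"
      using eventually_gt_at_top[of 0]
      by eventually_elim (simp add: F_def signed_powr_def std_normal_density_def)
    ultimately show ?thesis by (rule Lim_transform_eventually)
  qed
  have odd: "F (- x) = - F x" for x by (simp add: F_def signed_powr_minus std_normal_density_def)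
  have bot: "(F \<longlongrightarrow> 0) at_bot"
    unfolding at_bot_mirror filterlim_filtermap odd using tendsto_minus[OF top] by simp
  have "(LBINT x=-\<infinity>..\<infinity>. f x) = 0 - 0"
  proof (rule interval_integral_FTC_integrable[where F = F])
    show "isCont f x" for x
    proof -
      have "isCont (\<lambda>x. \<bar>x\<bar> powr (p - 2)) x" "isCont (\<lambda>x. \<bar>x\<bar> powr p) x"
        using assms by (intro DERIV_isCont[OF DERIV_abs_powr]; simp)+
      then show ?thesis unfolding f_def using DERIV_isCont[OF dens]
        by (auto intro!: continuous_intros )
    qed
    show "((F \<circ> real_of_ereal) \<longlongrightarrow> 0) (at_right (- \<infinity>))" "((F \<circ> real_of_ereal) \<longlongrightarrow> 0) (at_left \<infinity>)"
      using top bot by (simp_all add: ereal_tendsto_simps)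
    show "set_integrable lborel (einterval (- \<infinity>) \<infinity>) f" using f_int by (simp add: set_integrable_def)
  qed (use F in \<open>auto simp: has_real_derivative_iff_has_vector_derivative\<close>)
  then have "(\<integral>x. f x \<partial>lborel) = 0"
    by (simp add: interval_lebesgue_integral_def set_lebesgue_integral_def)
  also have "(\<integral>x. f x \<partial>lborel) = (\<integral>x. (p - 1) * \<bar>x\<bar> powr (p - 2) - \<bar>x\<bar> powr p \<partial>std_normal_distribution)"
    by (subst integral_density) (auto simp: f_def[abs_def] mult.commute)
  also have "\<dots> = (p - 1) * gauss_moment (p - 2) - gauss_moment p"
    unfolding gauss_moment_def using assms integrable_gauss_moment[of p] integrable_gauss_moment[of "p - 2"]
    by (subst Bochner_Integration.integral_diff) auto
  finally show ?thesis by simp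
qed

section \<open>Exponents between four and six\<close>

definition cos_remainder :: "real \<Rightarrow> real" where
  "cos_remainder x = x ^ 4 / 24 - x ^ 2 / 2 + 1 - cos x"

lemma cos_remainder_nonneg: "0 \<le> cos_remainder x"
  using cos_taylor_upper[of x] by (simp add: cos_remainder_def)

lemma cos_remainder_le6: "cos_remainder x \<le> x ^ 6 / 720"
  using cos_taylor_lower[of x] by (simp add: cos_remainder_def)

lemma cos_remainder_abs: "cos_remainder \<bar>x\<bar> = cos_remainder x"
  by (simp add: cos_remainder_def)

lemma borel_measurable_cos_remainder [measurable]: "cos_remainder \<in> borel_measurable borel"
  unfolding cos_remainder_def[abs_def] by measurable

definition cos_weight :: "real \<Rightarrow> real \<Rightarrow> real" where
  "cos_weight p t = indicator {0<..} t * t powr (- p - 1)"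

lemma cos_weight_nonneg: "0 \<le> cos_weight p t"
  by (simp add: cos_weight_def)

lemma borel_measurable_cos_weight [measurable]: "cos_weight p \<in> borel_measurable borel"
  unfolding cos_weight_def[abs_def] by measurable

text \<open>The constant of the mixture. It is divided out in the end, so it has to be positive and finite, and this
  confines \<open>p\<close> to the range \<open>4 < p < 6\<close>: the integrand is of order \<open>t powr (5 - p)\<close> at zero and \<open>t powr (3 - p)\<close> at infinity.\<close>

definition cos_const :: "real \<Rightarrow> ennreal" where
  "cos_const p = (\<integral>\<^sup>+t. ennreal (cos_remainder t * cos_weight p t) \<partial>lborel)"

text \<open>By the substitution \<open>t\<close> to \<open>|x| * t\<close>. In extended nonnegative reals it can be averaged over \<open>x\<close>
  without conditions of integrability.\<close>

lemma abs_powr_integral_repr: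
  fixes x :: real
  assumes "p > 0"
  shows "ennreal (\<bar>x\<bar> powr p) * cos_const p = (\<integral>\<^sup>+t. ennreal (cos_remainder (t * x) * cos_weight p t) \<partial>lborel)"
proof (cases "x = 0")
  case True
  then show ?thesis by (simp add: cos_remainder_def)
next
  case False
  define c where "c = \<bar>x\<bar>"
  have "c > 0" using False by (simp add: c_def)
  have "cos_const p = ennreal c * (\<integral>\<^sup>+t. ennreal (cos_remainder (0 + c * t) * cos_weight p (0 + c * t)) \<partial>lborel)"
    unfolding cos_const_def using \<open>c > 0\<close>
    by (subst nn_integral_real_affine[where c = c and t = 0]) auto
  also have "(\<integral>\<^sup>+t. ennreal (cos_remainder (0 + c * t) * cos_weight p (0 + c * t)) \<partial>lborel)
     = (\<integral>\<^sup>+t. ennreal (c powr (- p - 1)) * ennreal (cos_remainder (t * x) * cos_weight p t) \<partial>lborel)"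
  proof (intro nn_integral_cong)
    fix t
    have "cos_remainder (c * t) = cos_remainder (t * x)"
      using cos_remainder_abs[of "c * t"] cos_remainder_abs[of "t * x"]
      by (simp add: c_def abs_mult mult.commute)
    moreover have "cos_weight p (c * t) = c powr (- p - 1) * cos_weight p t"
      using \<open>c > 0\<close> by (auto simp: cos_weight_def indicator_def zero_less_mult_iff powr_mult)
    ultimately show "ennreal (cos_remainder (0 + c * t) * cos_weight p (0 + c * t))
       = ennreal (c powr (- p - 1)) * ennreal (cos_remainder (t * x) * cos_weight p t)"
      by (subst ennreal_mult[symmetric]) (auto simp: cos_remainder_nonneg cos_weight_nonneg ac_simps)
  qed
  also have "\<dots> = ennreal (c powr (- p - 1)) * (\<integral>\<^sup>+t. ennreal (cos_remainder (t * x) * cos_weight p t) \<partial>lborel)"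
    by (rule nn_integral_cmult) auto
  finally have "ennreal (c powr p) * cos_const p = (ennreal (c powr p) * ennreal c * ennreal (c powr (- p - 1)))
     * (\<integral>\<^sup>+t. ennreal (cos_remainder (t * x) * cos_weight p t) \<partial>lborel)"
    by (simp add: ac_simps)
  also have "ennreal (c powr p) * ennreal c * ennreal (c powr (- p - 1)) = 1"
  proof -
    have "c powr p * c * c powr (- p - 1) = c powr (p + 1 + (- p - 1))"
      unfolding powr_add using \<open>c > 0\<close> by simp
    then show ?thesis using \<open>c > 0\<close> by (simp flip: ennreal_mult)
  qed
  finally show ?thesis by (simp add: c_def)
qed

lemma cos_const_pos: "cos_const p \<noteq> 0" if "p > 0"
proof -
  have "ennreal (2 * 5 powr (- p - 1)) * emeasure lborel {4..5::real}
    = (\<integral>\<^sup>+t. ennreal (2 * 5 powr (- p - 1)) * indicator {4..5::real} t \<partial>lborel)"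
    by (simp add: nn_integral_cmult_indicator)
  also have "\<dots> \<le> cos_const p"
    unfolding cos_const_def
  proof (rule nn_integral_mono)
    fix t :: real
    have "2 * 5 powr (- p - 1) \<le> cos_remainder t * cos_weight p t" if t: "t \<in> {4..5}"
    proof (rule mult_mono)
      (* On this interval already t^4/24 - t^2/2 is at least 8/3. *)
      have "4 * 4 * (1 / 6) \<le> t * t * (t * t / 24 - 1 / 2)"
        using t mult_mono[of 4 t 4 t] by (intro mult_mono) auto
      then have "2 \<le> t ^ 4 / 24 - t ^ 2 / 2" by (simp add: power2_eq_square power4_eq_xxxx algebra_simps)
      then show "2 \<le> cos_remainder t" using cos_le_one[of t] unfolding cos_remainder_def by linarith
      show "5 powr (- p - 1) \<le> cos_weight p t"
        using t \<open>p > 0\<close> by (simp add: cos_weight_def powr_mono2')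
    qed (use cos_remainder_nonneg in auto)
    then show "ennreal (2 * 5 powr (- p - 1)) * indicator {4..5} t \<le> ennreal (cos_remainder t * cos_weight p t)"
      by (auto simp: indicator_def intro!: ennreal_leI)
  qed
  finally show ?thesis by (auto simp: ennreal_mult_eq_top_iff)
qed

lemma cos_const_finite:
  assumes "4 < p" "p < 6"
  shows "cos_const p \<noteq> \<infinity>"
proof -
  have i1: "(\<integral>\<^sup>+t. ennreal (indicator {0..1} t * t powr (5 - p)) \<partial>lborel) < \<infinity>"
  proof -
    have "((\<lambda>t. t powr (5 - p)) has_integral (1 powr (5 - p + 1) / (5 - p + 1))) {0..1::real}"
      using assms by (intro has_integral_powr_from_0) auto
    then have "((\<lambda>t. indicator {0..1} t * t powr (5 - p)) has_integral (1 powr (5 - p + 1) / (5 - p + 1))) UNIV"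
      unfolding has_integral_restrict_UNIV[of "{0..1}", symmetric]
      by (rule has_integral_eq[rotated]) auto
    from nn_integral_has_integral_lborel[OF _ _ this] show ?thesis by simp
  qed
  have i2: "(\<integral>\<^sup>+t. ennreal (indicator {1..} t * t powr (3 - p)) \<partial>lborel) < \<infinity>"
  proof -
    have "((\<lambda>t. t powr (3 - p)) has_integral (- (1 powr (3 - p + 1)) / (3 - p + 1))) {1::real..}"
      using assms by (intro has_integral_powr_to_inf) auto
    then have "((\<lambda>t. indicator {1..} t * t powr (3 - p)) has_integral (- (1 powr (3 - p + 1)) / (3 - p + 1))) UNIV"
      unfolding has_integral_restrict_UNIV[of "{1..}", symmetric]
      by (rule has_integral_eq[rotated]) auto
    from nn_integral_has_integral_lborel[OF _ _ this] show ?thesis by simp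
  qed
  have "cos_const p \<le> (\<integral>\<^sup>+t. ennreal (indicator {0..1} t * t powr (5 - p))
     + ennreal 3 * ennreal (indicator {1..} t * t powr (3 - p)) \<partial>lborel)"
    unfolding cos_const_def
  proof (rule nn_integral_mono)
    fix t :: real
    consider "t \<le> 0" | "0 < t" "t \<le> 1" | "1 < t" by linarith
    then have "cos_remainder t * cos_weight p t \<le> indicator {0..1} t * t powr (5 - p) + 3 * (indicator {1..} t * t powr (3 - p))"
    proof cases
      case 2
      have "0 \<le> t ^ 6" using 2 by simp
      then have "cos_remainder t \<le> t ^ 6" using cos_remainder_le6[of t] by linarith
      then have "cos_remainder t * cos_weight p t \<le> t ^ 6 * t powr (- p - 1)"
        using 2 by (intro mult_mono) (auto simp: cos_weight_def)
      also have "t ^ 6 * t powr (- p - 1) = t powr (5 - p)"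
        using 2 by (simp add: powr_add[symmetric] flip: powr_numeral)
      finally show ?thesis using 2 by (auto simp: indicator_def)
    next
      case 3
      have "1 \<le> t ^ 4" using 3 by (intro one_le_power) auto
      moreover have "0 \<le> t ^ 2" by simp
      ultimately have "cos_remainder t \<le> 3 * t ^ 4"
        using cos_ge_minus_one[of t] unfolding cos_remainder_def by linarith
      then have "cos_remainder t * cos_weight p t \<le> 3 * t ^ 4 * t powr (- p - 1)"
        using 3 by (intro mult_mono) (auto simp: cos_weight_def)
      also have "3 * t ^ 4 * t powr (- p - 1) = 3 * t powr (3 - p)"
        using 3 by (simp add: powr_add[symmetric] flip: powr_numeral)
      finally show ?thesis using 3 by simp
    qed (auto simp: cos_weight_def)
    moreover have "ennreal (A + 3 * B) = ennreal A + ennreal 3 * ennreal B" if "A \<ge> 0" "B \<ge> 0" for A B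
      using that by (subst ennreal_plus) (auto simp: ennreal_mult)
    ultimately show "ennreal (cos_remainder t * cos_weight p t) \<le> ennreal (indicator {0..1} t * t powr (5 - p))
     + ennreal 3 * ennreal (indicator {1..} t * t powr (3 - p))"
      by (metis ennreal_leI indicator_pos_le mult_nonneg_nonneg powr_ge_zero)
  qed
  also have "\<dots> < \<infinity>"
    using i1 i2 by (subst nn_integral_add) (auto simp: nn_integral_cmult ennreal_mult_less_top)
  finally show ?thesis by simp
qed

lemma sign_avg_abs_powr_repr:
  assumes "finite I" "p > 0"
  shows "ennreal (sign_avg I a (\<lambda>x. \<bar>x\<bar> powr p) x) * cos_const p
    = (\<integral>\<^sup>+t. ennreal (sign_avg I a (\<lambda>x. cos_remainder (t * x)) x * cos_weight p t) \<partial>lborel)"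
  using assms(1)
proof (induction I arbitrary: x rule: finite_induct)
  case empty
  then show ?case using abs_powr_integral_repr[OF assms(2), of x] by simp
next
  case (insert i I)
  let ?P = "\<lambda>y. sign_avg I a (\<lambda>x. \<bar>x\<bar> powr p) y" and ?K = "\<lambda>t y. sign_avg I a (\<lambda>x. cos_remainder (t * x)) y"
  have nonneg: "0 \<le> ?P y" "0 \<le> ?K t y" for y t
    by (auto intro!: sign_avg_nonneg cos_remainder_nonneg)
  have [measurable]: "(\<lambda>t. ?K t y) \<in> borel_measurable borel" for y
    unfolding sign_avg_def by measurable
  have "ennreal (sign_avg (insert i I) a (\<lambda>x. \<bar>x\<bar> powr p) x) * cos_const p
     = ennreal (1 / 2) * (ennreal (?P (x + a i)) * cos_const p + ennreal (?P (x - a i)) * cos_const p)"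
    unfolding distrib_right[symmetric] mult.assoc[symmetric] using insert.hyps nonneg
    by (subst ennreal_plus[symmetric], simp, simp, subst ennreal_mult[symmetric]) (auto simp: sign_avg_insert)
  also have "\<dots> = (\<integral>\<^sup>+t. ennreal (1 / 2) * (ennreal (?K t (x + a i) * cos_weight p t) + ennreal (?K t (x - a i) * cos_weight p t)) \<partial>lborel)"
    unfolding insert.IH by (subst nn_integral_cmult, simp, subst nn_integral_add) auto
  also have "\<dots> = (\<integral>\<^sup>+t. ennreal (sign_avg (insert i I) a (\<lambda>x. cos_remainder (t * x)) x * cos_weight p t) \<partial>lborel)"
    using insert.hyps nonneg cos_weight_nonneg
    by (intro nn_integral_cong, subst ennreal_plus[symmetric], simp, simp, subst ennreal_mult[symmetric])
       (auto simp: sign_avg_insert field_simps)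
  finally show ?case .
qed

lemma gauss_cos_remainder:
  fixes t :: real
  shows "integrable std_normal_distribution (\<lambda>x. cos_remainder (t * x))" (is ?I)
    and "(\<integral>x. cos_remainder (t * x) \<partial>std_normal_distribution) = t ^ 4 / 8 - t ^ 2 / 2 + 1 - exp (- (t ^ 2) / 2)" (is ?E)
proof -
  interpret N: prob_space std_normal_distribution
    by (rule prob_space_normal_density) simp
  have m4: "integrable std_normal_distribution (\<lambda>x. x ^ 4)" "(\<integral>x. x ^ 4 \<partial>std_normal_distribution) = 3"
    using integrable_std_normal_distribution_moment[of 4] gauss_moment_4 
    by (simp_all add: gauss_moment_def abs_powr_4)
  have m2: "integrable std_normal_distribution (\<lambda>x. x ^ 2)" "(\<integral>x. x ^ 2 \<partial>std_normal_distribution) = 1"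
    using integrable_std_normal_distribution_moment[of 2] std_normal_distribution_even_moments(1)[of 1] by simp_all
  have ie: "integrable std_normal_distribution (\<lambda>x. iexp (t * x))"
    by (rule N.integrable_iexp) simp_all
  have ci: "integrable std_normal_distribution (\<lambda>x. cos (t * x))"
    by (rule N.integrable_const_bound[where B = 1]) auto
  have "Re (char std_normal_distribution t) = (\<integral>x. cos (t * x) \<partial>std_normal_distribution)"
    unfolding char_def unfolding integral_Re[OF ie, symmetric] unfolding cis_conv_exp[symmetric] by simp
  then have c: "(\<integral>x. cos (t * x) \<partial>std_normal_distribution) = exp (- (t ^ 2) / 2)"
    by (simp only: char_std_normal_distribution Re_complex_of_real)
  show ?I unfolding cos_remainder_def power_mult_distrib using m4 m2 ci by simp
  show ?E unfolding cos_remainder_def power_mult_distrib using m4 m2 ci c N.prob_space by simp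
qed

lemma gauss_moment_repr:
  assumes "p > 0" "c \<ge> 0"
  shows "ennreal (c powr p * gauss_moment p) * cos_const p =
    (\<integral>\<^sup>+t. ennreal ((\<integral>x. cos_remainder (t * c * x) \<partial>std_normal_distribution) * cos_weight p t) \<partial>lborel)"
proof -
  interpret N: prob_space std_normal_distribution
    by (rule prob_space_normal_density) simp
  interpret P: pair_sigma_finite std_normal_distribution lborel ..
  have "ennreal (c powr p * gauss_moment p) = (\<integral>\<^sup>+x. ennreal (\<bar>c * x\<bar> powr p) \<partial>std_normal_distribution)"
    unfolding gauss_moment_def using assms integrable_gauss_moment[of p]
    by (subst nn_integral_eq_integral) (auto simp: abs_mult powr_mult)
  then have "ennreal (c powr p * gauss_moment p) * cos_const p
     = (\<integral>\<^sup>+x. ennreal (\<bar>c * x\<bar> powr p) * cos_const p \<partial>std_normal_distribution)"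
    by (simp add: nn_integral_multc)
  also have "\<dots> = (\<integral>\<^sup>+x. (\<integral>\<^sup>+t. ennreal (cos_remainder (t * (c * x)) * cos_weight p t) \<partial>lborel) \<partial>std_normal_distribution)"
    by (simp only: abs_powr_integral_repr[OF assms(1)])
  also have "\<dots> = (\<integral>\<^sup>+t. (\<integral>\<^sup>+x. ennreal (cos_remainder (t * (c * x)) * cos_weight p t) \<partial>std_normal_distribution) \<partial>lborel)"
    by (rule P.Fubini'[symmetric]) simp
  also have "\<dots> = (\<integral>\<^sup>+t. ennreal ((\<integral>x. cos_remainder (t * c * x) \<partial>std_normal_distribution) * cos_weight p t) \<partial>lborel)"
  proof (intro nn_integral_cong)
    fix t
    have "(\<integral>\<^sup>+x. ennreal (cos_remainder (t * c * x) * cos_weight p t) \<partial>std_normal_distribution)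
      = ennreal (\<integral>x. cos_remainder (t * c * x) * cos_weight p t \<partial>std_normal_distribution)"
      using gauss_cos_remainder(1)[of "t * c"] cos_remainder_nonneg cos_weight_nonneg
      by (intro nn_integral_eq_integral) auto
    then show "(\<integral>\<^sup>+x. ennreal (cos_remainder (t * (c * x)) * cos_weight p t) \<partial>std_normal_distribution)
      = ennreal ((\<integral>x. cos_remainder (t * c * x) \<partial>std_normal_distribution) * cos_weight p t)"
      by (simp add: mult.assoc)
  qed
  finally show ?thesis .
qed

text \<open>Both sides have the same fourth moment term, and the second moments and the characteristic functions are
  compared by \<open>prod_cos_ge\<close> at the angles \<open>t * a i\<close>.\<close>

lemma sign_avg_cos_remainder_le:
  fixes a :: "'i \<Rightarrow> real" and \<sigma> t :: real
  assumes fin: "finite I" and "\<sigma> \<ge> 0"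
    and \<sigma>: "\<sigma> ^ 2 = (\<Sum>i\<in>I. a i ^ 2) ^ 2 - 2 / 3 * (\<Sum>i\<in>I. a i ^ 4)"
  shows "sign_avg I a (\<lambda>x. cos_remainder (t * x)) 0 
    \<le> (\<integral>x. cos_remainder (t * sqrt \<sigma> * x) \<partial>std_normal_distribution)"
proof -
  define V where "V = (\<Sum>i\<in>I. a i ^ 2)"
  have "sign_avg I a (\<lambda>x. cos_remainder (t * x)) 0 
    = sign_avg I a (\<lambda>x. (t ^ 4 / 24 * x ^ 4 - t ^ 2 / 2 * x ^ 2 + 1) - cos (t * x)) 0"
    by (simp add: cos_remainder_def power_mult_distrib)
  also have "\<dots> = t ^ 4 / 24 * (3 * V ^ 2 - 2 * (\<Sum>i\<in>I. a i ^ 4)) - t ^ 2 / 2 * V + 1 - (\<Prod>i\<in>I. cos (t * a i))"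
    using fin by (simp add: sign_avg_diff sign_avg_add sign_avg_cmult[of I a "t ^ 4 / 24"] sign_avg_cmult[of I a "t ^ 2 / 2"] 
        sign_avg_const sign_avg_square sign_avg_fourth sign_avg_cos V_def del: times_divide_eq_left)
  also have "3 * V ^ 2 - 2 * (\<Sum>i\<in>I. a i ^ 4) = 3 * \<sigma> ^ 2" by (simp add: \<sigma> V_def)
  also have "t ^ 4 / 24 * (3 * \<sigma> ^ 2) - t ^ 2 / 2 * V + 1 - (\<Prod>i\<in>I. cos (t * a i))
    \<le> t ^ 4 / 8 * \<sigma> ^ 2 - t ^ 2 / 2 * \<sigma> + 1 - exp (- (t ^ 2 * \<sigma>) / 2)"
  proof -
    have "exp (- (t ^ 2 * \<sigma>) / 2) - ((\<Sum>i\<in>I. (t * a i) ^ 2) - t ^ 2 * \<sigma>) / 2 \<le> (\<Prod>i\<in>I. cos (t * a i))"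
    proof (rule prod_cos_ge[OF fin])
      have "(t ^ 2 * \<sigma>) ^ 2 = t ^ 4 * \<sigma> ^ 2" by (simp add: power_mult_distrib flip: power_mult)
      then show "(t ^ 2 * \<sigma>) ^ 2 = (\<Sum>i\<in>I. (t * a i) ^ 2) ^ 2 - 2 / 3 * (\<Sum>i\<in>I. (t * a i) ^ 4)"
        unfolding \<sigma> power_mult_distrib sum_distrib_left[symmetric]
        by (simp add: right_diff_distrib flip: power_mult)
    qed (use \<open>\<sigma> \<ge> 0\<close> in simp)
    then show ?thesis 
      by (simp add: V_def power_mult_distrib algebra_simps diff_divide_distrib flip: sum_distrib_left)
  qed
  also have "\<dots> = (\<integral>x. cos_remainder (t * sqrt \<sigma> * x) \<partial>std_normal_distribution)"
  proof -
    have "sqrt \<sigma> ^ 4 = (sqrt \<sigma> ^ 2) ^ 2" by (simp flip: power_mult)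
    then show ?thesis
      unfolding gauss_cos_remainder(2) power_mult_distrib using \<open>\<sigma> \<ge> 0\<close> by simp
  qed
  finally show ?thesis .
qed

lemma sign_avg_moment_4_6:
  fixes a :: "'i \<Rightarrow> real" and \<sigma> p :: real
  assumes "finite I" and "\<sigma> \<ge> 0"
    and "\<sigma> ^ 2 = (\<Sum>i\<in>I. a i ^ 2) ^ 2 - 2 / 3 * (\<Sum>i\<in>I. a i ^ 4)" and p: "4 < p" "p < 6"
  shows "sign_avg I a (\<lambda>x. \<bar>x\<bar> powr p) 0 \<le> gauss_moment p * \<sigma> powr (p / 2)"
proof -
  have "ennreal (sign_avg I a (\<lambda>x. \<bar>x\<bar> powr p) 0) * cos_const p
    = (\<integral>\<^sup>+t. ennreal (sign_avg I a (\<lambda>x. cos_remainder (t * x)) 0 * cos_weight p t) \<partial>lborel)"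
    using assms by (intro sign_avg_abs_powr_repr) auto
  also have "\<dots> \<le> (\<integral>\<^sup>+t. ennreal ((\<integral>x. cos_remainder (t * sqrt \<sigma> * x) \<partial>std_normal_distribution) * cos_weight p t) \<partial>lborel)"
    using sign_avg_cos_remainder_le[OF assms(1-3)] cos_weight_nonneg
    by (intro nn_integral_mono ennreal_leI mult_right_mono) auto
  also have "\<dots> = ennreal (sqrt \<sigma> powr p * gauss_moment p) * cos_const p"
    using assms by (intro gauss_moment_repr[symmetric]) auto
  finally have "ennreal (sign_avg I a (\<lambda>x. \<bar>x\<bar> powr p) 0) \<le> ennreal (sqrt \<sigma> powr p * gauss_moment p)"
    using cos_const_pos[of p] cos_const_finite[OF p] p
    by (subst (asm) (1 2) mult.commute, subst (asm) ennreal_mult_le_mult_iff) auto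
  then have "sign_avg I a (\<lambda>x. \<bar>x\<bar> powr p) 0 \<le> sqrt \<sigma> powr p * gauss_moment p"
    using gauss_moment_nonneg by (simp add: ennreal_le_iff)
  also have "sqrt \<sigma> powr p = \<sigma> powr (p / 2)"
    using \<open>\<sigma> \<ge> 0\<close> by (simp add: powr_half_sqrt[symmetric] powr_powr)
  finally show ?thesis by (simp add: mult.commute)
qed

text \<open>Induction in steps of two from the range \<open>4 \<le> p < 6\<close>.\<close>

lemma sign_avg_moment_le:
  fixes a :: "'i \<Rightarrow> real" and \<sigma> p :: real
  assumes "finite I" and "\<sigma> \<ge> 0"
    and \<sigma>: "\<sigma> ^ 2 = (\<Sum>i\<in>I. a i ^ 2) ^ 2 - 2 / 3 * (\<Sum>i\<in>I. a i ^ 4)" and "4 \<le> p"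
  shows "sign_avg I a (\<lambda>x. \<bar>x\<bar> powr p) 0 \<le> gauss_moment p * \<sigma> powr (p / 2)"
proof -
  have "sign_avg I a (\<lambda>x. \<bar>x\<bar> powr p) 0 \<le> gauss_moment p * \<sigma> powr (p / 2)"
    if "4 \<le> p" "p < 6 + 2 * real n" for n p
    using that
  proof (induction n arbitrary: p)
    case 0
    show ?case
    proof (cases "p = 4")
      case True
      have "sign_avg I a (\<lambda>x. \<bar>x\<bar> powr p) 0 = 3 * \<sigma> ^ 2"
        using assms(1) by (simp add: True abs_powr_4 sign_avg_fourth \<sigma>)
      moreover have "\<sigma> powr (p / 2) = \<sigma> ^ 2"
        using \<open>\<sigma> \<ge> 0\<close> by (simp add: True powr_numeral)
      ultimately show ?thesis by (simp add: True gauss_moment_4)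
    next
      case False
      then show ?thesis using 0 assms by (intro sign_avg_moment_4_6) auto
    qed
  next
    case (Suc n)
    show ?case
    proof (cases "p < 6")
      case True
      then show ?thesis using Suc by simp
    next
      case False
      have "sign_avg I a (\<lambda>x. \<bar>x\<bar> powr p) 0 \<le> (p - 1) * \<sigma> * sign_avg I a (\<lambda>x. \<bar>x\<bar> powr (p - 2)) 0"
        using False assms by (intro sign_avg_moment_step) auto
      also have "\<dots> \<le> (p - 1) * \<sigma> * (gauss_moment (p - 2) * \<sigma> powr ((p - 2) / 2))"
        using False Suc.prems \<open>\<sigma> \<ge> 0\<close> by (intro mult_left_mono Suc.IH) auto
      also have "\<dots> = ((p - 1) * gauss_moment (p - 2)) * (\<sigma> * \<sigma> powr ((p - 2) / 2))" by simp
      also have "(p - 1) * gauss_moment (p - 2) = gauss_moment p"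
        using False by (intro gauss_moment_rec[symmetric]) simp
      also have "\<sigma> * \<sigma> powr ((p - 2) / 2) = \<sigma> powr (p / 2)"
        using \<open>\<sigma> \<ge> 0\<close> by (simp add: powr_mult_base diff_divide_distrib)
      finally show ?thesis .
    qed
  qed
  moreover have "p < 6 + 2 * real (nat \<lceil>p\<rceil>)" using \<open>4 \<le> p\<close> by linarith
  ultimately show ?thesis using \<open>4 \<le> p\<close> by blast
qed

section \<open>Rademacher sums and optimality\<close>

text \<open>Induction on \<open>I\<close>: the new sign is independent of the sum over \<open>I\<close>, and the integrand splits
  according to its two values.\<close>

lemma rademacher_expectation:
  fixes \<epsilon> :: "nat \<Rightarrow> 'a \<Rightarrow> real" and f :: "real \<Rightarrow> real"
  assumes rad: "rademacher_seq M \<epsilon>" and f [measurable]: "f \<in> borel_measurable borel" and "finite I"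
  shows "integrable M (\<lambda>\<omega>. f (x + (\<Sum>i\<in>I. a i * \<epsilon> i \<omega>))) \<and>
    (\<integral>\<omega>. f (x + (\<Sum>i\<in>I. a i * \<epsilon> i \<omega>)) \<partial>M) = sign_avg I a f x"
proof -
  interpret prob_space M using rad by (simp add: rademacher_seq_def)
  have indep: "indep_vars (\<lambda>_. borel) \<epsilon> UNIV"
    and half: "prob {\<omega> \<in> space M. \<epsilon> i \<omega> = 1} = 1 / 2" "prob {\<omega> \<in> space M. \<epsilon> i \<omega> = - 1} = 1 / 2" for i
    using rad by (auto simp: rademacher_seq_def)
  have [measurable]: "\<epsilon> i \<in> borel_measurable M" for i
    using indep by (simp add: indep_vars_def2)
  have AE_sign: "AE \<omega> in M. \<epsilon> i \<omega> = 1 \<or> \<epsilon> i \<omega> = - 1" for i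
  proof -
    have "prob ({\<omega> \<in> space M. \<epsilon> i \<omega> = 1} \<union> {\<omega> \<in> space M. \<epsilon> i \<omega> = - 1})
      = prob {\<omega> \<in> space M. \<epsilon> i \<omega> = 1} + prob {\<omega> \<in> space M. \<epsilon> i \<omega> = - 1}"
      by (rule finite_measure_Union) auto
    then have "prob {\<omega> \<in> space M. \<epsilon> i \<omega> = 1 \<or> \<epsilon> i \<omega> = - 1} = 1"
      unfolding half by (simp add: conj_disj_distribL flip: Collect_disj_eq)
    then show ?thesis by (subst (asm) prob_Collect_eq_1) auto
  qed
  have half': "expectation (\<lambda>\<omega>. indicator {s} (\<epsilon> i \<omega>)) = (1 / 2 :: real)" if "s = 1 \<or> s = - 1" for i s
  proof -
    have "expectation (\<lambda>\<omega>. indicator {s} (\<epsilon> i \<omega>)) = expectation (indicator {\<omega> \<in> space M. \<epsilon> i \<omega> = s} :: _ \<Rightarrow> real)"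
      by (intro Bochner_Integration.integral_cong) (auto simp: indicator_def)
    then show ?thesis using half[of i] that by auto
  qed
  show ?thesis
    using \<open>finite I\<close>
  proof (induction I arbitrary: x rule: finite_induct)
    case empty
    then show ?case by (simp add: prob_space)
  next
    case (insert i I)
    define S where "S \<omega> = (\<Sum>j\<in>I. a j * \<epsilon> j \<omega>)" for \<omega>
    have [measurable]: "S \<in> borel_measurable M" unfolding S_def by measurable
    have indS: "indep_var borel (\<epsilon> i) borel S"
    proof -
      (* With coefficient 1 at i, the i-th summand is the sign itself. *)
      define b where "b j = (if j = i then 1 else a j)" for j
      have "indep_vars (\<lambda>_. borel) (\<lambda>j \<omega>. b j * \<epsilon> j \<omega>) (insert i I)"
        by (rule indep_vars_compose2[where Y = "\<lambda>j y. b j * y", OF indep_vars_subset[OF indep]]) auto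
      from indep_vars_sum[OF insert.hyps this]
      have "indep_var borel (\<lambda>\<omega>. b i * \<epsilon> i \<omega>) borel (\<lambda>\<omega>. \<Sum>j\<in>I. b j * \<epsilon> j \<omega>)" .
      moreover have "(\<lambda>\<omega>. b i * \<epsilon> i \<omega>) = \<epsilon> i" by (simp add: b_def)
      moreover have "(\<lambda>\<omega>. \<Sum>j\<in>I. b j * \<epsilon> j \<omega>) = S"
        unfolding S_def b_def using insert.hyps by (intro ext sum.cong) auto
      ultimately show ?thesis by simp
    qed
    have half_part: "integrable M (\<lambda>\<omega>. indicator {s} (\<epsilon> i \<omega>) * f (x + s * a i + S \<omega>)) \<and>
       expectation (\<lambda>\<omega>. indicator {s} (\<epsilon> i \<omega>) * f (x + s * a i + S \<omega>)) = sign_avg I a f (x + s * a i) / 2"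
      if s: "s = 1 \<or> s = - 1" for s :: real
    proof -
      have ind: "indep_var borel (\<lambda>\<omega>. indicator {s} (\<epsilon> i \<omega>) :: real) borel (\<lambda>\<omega>. f (x + s * a i + S \<omega>))"
        using indep_var_compose[OF indS, of "indicator {s}" borel "\<lambda>y. f (x + s * a i + y)" borel] by (simp add: comp_def)
      have int: "integrable M (\<lambda>\<omega>. indicator {s} (\<epsilon> i \<omega>) :: real)"
        by (rule integrable_const_bound[where B = 1]) auto
      note IH = insert.IH[of "x + s * a i", folded S_def]
      show ?thesis
        using indep_var_integrable[OF ind int conjunct1[OF IH]]
          indep_var_lebesgue_integral[OF ind int conjunct1[OF IH]] IH half'[OF s, of i] by simp
    qed
    let ?g = "\<lambda>\<omega>. indicator {1} (\<epsilon> i \<omega>) * f (x + 1 * a i + S \<omega>) + indicator {- 1} (\<epsilon> i \<omega>) * f (x + - 1 * a i + S \<omega>)"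
    have AE: "AE \<omega> in M. f (x + (\<Sum>j\<in>insert i I. a j * \<epsilon> j \<omega>)) = ?g \<omega>"
      using AE_sign[of i] by eventually_elim (use insert.hyps in \<open>auto simp: S_def algebra_simps\<close>)
    have "integrable M ?g" "expectation ?g = sign_avg I a f (x + 1 * a i) / 2 + sign_avg I a f (x + - 1 * a i) / 2"
      using half_part[of 1] half_part[of "- 1"] by simp_all
    moreover have "integrable M (\<lambda>\<omega>. f (x + (\<Sum>j\<in>insert i I. a j * \<epsilon> j \<omega>))) \<longleftrightarrow> integrable M ?g"
      by (intro integrable_cong_AE AE) measurable
    moreover have "expectation (\<lambda>\<omega>. f (x + (\<Sum>j\<in>insert i I. a j * \<epsilon> j \<omega>))) = expectation ?g"
      by (intro integral_cong_AE AE) measurable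
    ultimately show ?case
      using insert.hyps by (simp add: sign_avg_insert)
  qed
qed

lemma rademacher_sum_moment:
  assumes "rademacher_seq M \<epsilon>"
  shows "Lp_norm M p (rademacher_sum \<epsilon> n a) = sign_avg {..<n} a (\<lambda>x. \<bar>x\<bar> powr p) 0 powr (1 / p)"
  unfolding Lp_norm_def rademacher_sum_def
  using rademacher_expectation[OF assms, of "\<lambda>x. \<bar>x\<bar> powr p" "{..<n}" 0 a] by simp

lemma gaussian_norm_eq: "gaussian_norm p = gauss_moment p powr (1 / p)"
  by (simp add: gaussian_norm_def Lp_norm_def gauss_moment_def)

lemma rademacher_CLT:
  assumes rad: "rademacher_seq M \<epsilon>"
  shows "weak_conv_m (\<lambda>n. distr M borel (rademacher_sum \<epsilon> n (\<lambda>_. 1 / sqrt (real n)))) std_normal_distribution"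
proof -
  interpret prob_space M using rad by (simp add: rademacher_seq_def)
  have indep: "indep_vars (\<lambda>_. borel) \<epsilon> UNIV" using rad by (auto simp: rademacher_seq_def)
  then have [measurable]: "\<epsilon> i \<in> borel_measurable M" for i by (simp add: indep_vars_def2)
  have one: "integrable M (\<lambda>\<omega>. f (\<epsilon> i \<omega>))" "expectation (\<lambda>\<omega>. f (\<epsilon> i \<omega>)) = (f 1 + f (- 1)) / 2"
    if "f \<in> borel_measurable borel" for i and f :: "real \<Rightarrow> real"
    using rademacher_expectation[OF rad that, of "{i}" 0 "\<lambda>_. 1"] sign_avg_insert[of "{}" i "\<lambda>_. 1" f 0] by simp_all
  have "weak_conv_m (\<lambda>n. distr M borel (\<lambda>\<omega>. (\<Sum>i<n. \<epsilon> i \<omega>) / sqrt (real n * 1\<^sup>2))) std_normal_distribution"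
  proof (rule central_limit_theorem_zero_mean[where \<mu> = "distr M borel (\<epsilon> 0)"])
    show mean: "expectation (\<epsilon> n) = 0" for n using one(2)[of "\<lambda>x. x" n] by simp
    show "integrable M (\<lambda>x. (\<epsilon> n x)\<^sup>2)" for n using one(1)[of "\<lambda>x. x\<^sup>2" n] by simp
    show "variance (\<epsilon> n) = 1\<^sup>2" for n unfolding mean using one(2)[of "\<lambda>x. x\<^sup>2" n] by simp
    show "distr M borel (\<epsilon> n) = distr M borel (\<epsilon> 0)" for n
    proof (rule measure_eqI)
      fix A assume "A \<in> sets (distr M borel (\<epsilon> n))"
      then have [measurable]: "A \<in> sets borel" by simp
      have "prob (\<epsilon> k -` A \<inter> space M) = (indicator A 1 + indicator A (- 1)) / 2" for k
      proof -
        have "prob (\<epsilon> k -` A \<inter> space M) = expectation (indicator (\<epsilon> k -` A \<inter> space M))" by simp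
        also have "\<dots> = expectation (\<lambda>\<omega>. indicator A (\<epsilon> k \<omega>))"
          by (intro Bochner_Integration.integral_cong) (auto simp: indicator_def)
        finally show ?thesis using one(2)[of "indicator A" k] by simp
      qed
      then have "prob (\<epsilon> n -` A \<inter> space M) = prob (\<epsilon> 0 -` A \<inter> space M)" by metis
      then show "emeasure (distr M borel (\<epsilon> n)) A = emeasure (distr M borel (\<epsilon> 0)) A"
        by (simp add: emeasure_distr emeasure_eq_measure)
    qed simp
  qed (use indep in simp_all)
  then show ?thesis
    by (simp add: rademacher_sum_def[abs_def] sum_divide_distrib)
qed

text \<open>Convergence in distribution gives convergence of the truncated moments only, but those are below the
  full moments, so an upper bound survives both the limit in \<open>n\<close> and the removal of the truncation.\<close>

lemma gaussian_norm_le_of_bound: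
  assumes rad: "rademacher_seq M \<epsilon>" and "p \<ge> 4" and "L \<ge> 0"
    and bound: "\<And>n. n \<ge> 1 \<Longrightarrow> Lp_norm M p (rademacher_sum \<epsilon> n (\<lambda>_. 1 / sqrt (real n))) \<le> L"
  shows "gaussian_norm p \<le> L"
proof -
  interpret prob_space M using rad by (simp add: rademacher_seq_def)
  define S where "S n = rademacher_sum \<epsilon> n (\<lambda>_. 1 / sqrt (real n))" for n
  have [measurable]: "\<epsilon> i \<in> borel_measurable M" for i
    using rad by (auto simp: rademacher_seq_def indep_vars_def2)
  have [measurable]: "S n \<in> borel_measurable M" for n
    unfolding S_def rademacher_sum_def[abs_def] by measurable
  have moment: "expectation (\<lambda>\<omega>. \<bar>S n \<omega>\<bar> powr p) \<le> L powr p" if "n \<ge> 1" for n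
  proof -
    have "0 \<le> expectation (\<lambda>\<omega>. \<bar>S n \<omega>\<bar> powr p)" by simp
    then have "expectation (\<lambda>\<omega>. \<bar>S n \<omega>\<bar> powr p) = Lp_norm M p (S n) powr p"
      using \<open>p \<ge> 4\<close> by (simp add: Lp_norm_def powr_powr)
    also have "\<dots> \<le> L powr p"
      using bound[OF that] \<open>p \<ge> 4\<close> by (intro powr_mono2) (auto simp: S_def Lp_norm_def)
    finally show ?thesis .
  qed
  have int: "integrable M (\<lambda>\<omega>. \<bar>S n \<omega>\<bar> powr p)" for n
    using rademacher_expectation[OF rad, of "\<lambda>x. \<bar>x\<bar> powr p" "{..<n}" 0 "\<lambda>_. 1 / sqrt (real n)"] 
    by (simp add: S_def rademacher_sum_def)
  have trunc: "(\<integral>x. min (\<bar>x\<bar> powr p) (real k) \<partial>std_normal_distribution) \<le> L powr p" for k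
  proof (rule LIMSEQ_le_const2)
    have dist: "real_distribution (distr M borel (S n))" for n
      by (rule real_distribution_distr) simp
    show "(\<lambda>n. \<integral>x. min (\<bar>x\<bar> powr p) (real k) \<partial>distr M borel (S n)) 
      \<longlonglongrightarrow> (\<integral>x. min (\<bar>x\<bar> powr p) (real k) \<partial>std_normal_distribution)"
    proof (rule weak_conv_imp_integral_bdd_continuous_conv[OF dist real_dist_normal_dist])
      show "weak_conv_m (\<lambda>n. distr M borel (S n)) std_normal_distribution"
        unfolding S_def by (rule rademacher_CLT[OF rad])
      have "isCont (\<lambda>x. \<bar>x\<bar> powr p) x" for x
        using \<open>p \<ge> 4\<close> by (intro DERIV_isCont[OF DERIV_abs_powr]) simp
      then show "isCont (\<lambda>x. min (\<bar>x\<bar> powr p) (real k)) x" for x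
        by (intro continuous_min continuous_const)
      show "norm (min (\<bar>x\<bar> powr p) (real k)) \<le> real k" for x by simp
    qed
    show "\<exists>N. \<forall>n\<ge>N. (\<integral>x. min (\<bar>x\<bar> powr p) (real k) \<partial>distr M borel (S n)) \<le> L powr p"
    proof (intro exI[of _ 1] allI impI)
      fix n :: nat assume "n \<ge> 1"
      have "(\<integral>x. min (\<bar>x\<bar> powr p) (real k) \<partial>distr M borel (S n)) 
         = expectation (\<lambda>\<omega>. min (\<bar>S n \<omega>\<bar> powr p) (real k))"
        by (rule integral_distr) auto
      also have "\<dots> \<le> expectation (\<lambda>\<omega>. \<bar>S n \<omega>\<bar> powr p)"
        by (intro integral_mono int) (auto intro: integrable_min int)
      also have "\<dots> \<le> L powr p" by (rule moment) fact
      finally show "(\<integral>x. min (\<bar>x\<bar> powr p) (real k) \<partial>distr M borel (S n)) \<le> L powr p" .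
    qed
  qed
  have "(\<lambda>k. \<integral>x. min (\<bar>x\<bar> powr p) (real k) \<partial>std_normal_distribution) \<longlonglongrightarrow> gauss_moment p"
    unfolding gauss_moment_def
  proof (rule integral_dominated_convergence[where w = "\<lambda>x. \<bar>x\<bar> powr p"])
    show "AE x in std_normal_distribution. (\<lambda>k. min (\<bar>x\<bar> powr p) (real k)) \<longlonglongrightarrow> \<bar>x\<bar> powr p"
    proof (intro AE_I2)
      fix x :: real
      obtain N :: nat where "\<bar>x\<bar> powr p \<le> real N" using real_arch_simple by blast
      then have "\<forall>\<^sub>F k in sequentially. min (\<bar>x\<bar> powr p) (real k) = \<bar>x\<bar> powr p"
        by (intro eventually_sequentiallyI[of N]) (simp add: min_def)
      then show "(\<lambda>k. min (\<bar>x\<bar> powr p) (real k)) \<longlonglongrightarrow> \<bar>x\<bar> powr p" by (rule tendsto_eventually)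
    qed
  qed (use \<open>p \<ge> 4\<close> integrable_gauss_moment[of p] in auto)
  then have "gauss_moment p \<le> L powr p"
    using trunc by (intro LIMSEQ_le_const2) auto
  then have "gauss_moment p powr (1 / p) \<le> (L powr p) powr (1 / p)"
    using \<open>p \<ge> 4\<close> gauss_moment_nonneg by (intro powr_mono2) auto
  then show ?thesis using \<open>p \<ge> 4\<close> \<open>L \<ge> 0\<close> by (simp add: gaussian_norm_eq powr_powr)
qed

theorem theorem1:
  fixes M :: "'a measure" and \<epsilon> :: "nat \<Rightarrow> 'a \<Rightarrow> real" and p :: real
  assumes "rademacher_seq M \<epsilon>"
    and "p \<ge> 4"
  shows "is_best_khinchine_const M \<epsilon> p 4 (gaussian_norm p / gaussian_norm 4)"
  unfolding is_best_khinchine_const_def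
proof (intro conjI allI impI)
  have g4: "gaussian_norm 4 = 3 powr (1 / 4)" by (simp add: gaussian_norm_eq gauss_moment_4)
  have norm4: "Lp_norm M 4 (rademacher_sum \<epsilon> n a) 
    = (3 * (\<Sum>i<n. a i ^ 2) ^ 2 - 2 * (\<Sum>i<n. a i ^ 4)) powr (1 / 4)" for n a
    by (simp add: rademacher_sum_moment[OF assms(1)] abs_powr_4 sign_avg_fourth)
  show "khinchine_bound M \<epsilon> p 4 (gaussian_norm p / gaussian_norm 4)"
    unfolding khinchine_bound_def
  proof (intro allI impI)
    fix n :: nat and a :: "nat \<Rightarrow> real"
    let ?V = "\<Sum>i<n. a i ^ 2" and ?Q = "\<Sum>i<n. a i ^ 4"
    define \<sigma> where "\<sigma> = sqrt (?V ^ 2 - 2 / 3 * ?Q)"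
    have "0 \<le> sign_avg {..<n} a (\<lambda>x. x ^ 4) 0" by (rule sign_avg_nonneg) simp
    then have "0 \<le> ?V ^ 2 - 2 / 3 * ?Q" by (simp add: sign_avg_fourth)
    then have \<sigma>: "\<sigma> ^ 2 = ?V ^ 2 - 2 / 3 * ?Q" "\<sigma> \<ge> 0" by (simp_all add: \<sigma>_def)
    have "Lp_norm M p (rademacher_sum \<epsilon> n a) \<le> (gauss_moment p * \<sigma> powr (p / 2)) powr (1 / p)"
      unfolding rademacher_sum_moment[OF assms(1)] using assms(2) \<sigma>
      by (intro powr_mono2 sign_avg_moment_le sign_avg_nonneg) auto
    also have "\<dots> = gaussian_norm p * \<sigma> powr (1 / 2)"
      using assms(2) by (simp add: powr_mult gauss_moment_nonneg powr_powr gaussian_norm_eq)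
    also have "\<sigma> powr (1 / 2) = Lp_norm M 4 (rademacher_sum \<epsilon> n a) / gaussian_norm 4"
    proof -
      have "3 * ?V ^ 2 - 2 * ?Q = 3 * \<sigma> ^ 2" by (simp add: \<sigma>)
      then have "Lp_norm M 4 (rademacher_sum \<epsilon> n a) = 3 powr (1 / 4) * (\<sigma> ^ 2) powr (1 / 4)"
        unfolding norm4 by (simp add: powr_mult)
      also have "(\<sigma> ^ 2) powr (1 / 4) = \<sigma> powr (1 / 2)"
        using \<sigma>(2) by (simp add: powr_powr flip: powr_numeral)
      finally show ?thesis by (simp add: g4)
    qed
    finally show "Lp_norm M p (rademacher_sum \<epsilon> n a)
      \<le> gaussian_norm p / gaussian_norm 4 * Lp_norm M 4 (rademacher_sum \<epsilon> n a)" by simp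
  qed
next
  fix C assume C: "khinchine_bound M \<epsilon> p 4 C"
  have norm4: "Lp_norm M 4 (rademacher_sum \<epsilon> n (\<lambda>_. 1 / sqrt (real n))) = (3 - 2 / real n) powr (1 / 4)" 
    if "n \<ge> 1" for n
  proof -
    have "(1 / sqrt (real n)) ^ 4 = ((1 / sqrt (real n)) ^ 2) ^ 2" by (simp flip: power_mult)
    then have "(1 / sqrt (real n)) ^ 4 = 1 / real n ^ 2" by (simp add: power_divide)
    then show ?thesis 
      using that by (simp add: rademacher_sum_moment[OF assms(1)] abs_powr_4 sign_avg_fourth power_divide power2_eq_square)
  qed
  have C': "Lp_norm M p (rademacher_sum \<epsilon> n (\<lambda>_. 1 / sqrt (real n))) \<le> C * (3 - 2 / real n) powr (1 / 4)"
    if "n \<ge> 1" for n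
    using C that unfolding khinchine_bound_def norm4[OF that, symmetric] by blast
  have "0 \<le> Lp_norm M p (rademacher_sum \<epsilon> 1 (\<lambda>_. 1 / sqrt (real 1)))" by (simp add: Lp_norm_def)
  also have "\<dots> \<le> C" using C'[of 1] by simp
  finally have "C \<ge> 0" .
  have "gaussian_norm p \<le> C * 3 powr (1 / 4)"
  proof (rule gaussian_norm_le_of_bound[OF assms])
    fix n :: nat assume "n \<ge> 1"
    have "C * (3 - 2 / real n) powr (1 / 4) \<le> C * 3 powr (1 / 4)"
      using \<open>C \<ge> 0\<close> \<open>n \<ge> 1\<close> by (intro mult_left_mono powr_mono2) (auto simp: field_simps)
    with C'[OF \<open>n \<ge> 1\<close>] show "Lp_norm M p (rademacher_sum \<epsilon> n (\<lambda>_. 1 / sqrt (real n))) \<le> C * 3 powr (1 / 4)"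
      by linarith
  qed (use \<open>C \<ge> 0\<close> in simp)
  then show "gaussian_norm p / gaussian_norm 4 \<le> C"
    by (simp add: gaussian_norm_eq gauss_moment_4 field_simps)
qed

end
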